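(* Let $(E,\rho,[\cdot,\cdot]_E,L)$ be a local almost-Leibniz algebroid over $M$ and let $\nabla$ be a linear $E$-connection. Then $(E,\rho,[\cdot,\cdot]_E^{\nabla})$ is an almost-dull algebroid, where $[u,v]_E^{\nabla}:=[u,v]_E-L(e^a,\nabla_{X_a}u,v)$. Moreover, if $\nabla$ is an admissible linear $E$-connection, then $(E,\rho,[\cdot,\cdot]_E^{\nabla})$ is an almost-Lie algebroid.
   Context: Everything is smooth. $M$ is a manifold, $E\to M$ a real vector bundle of constant rank, $\mathfrak{X}(E)=\Gamma(E)$, $\Omega^1(E)=\Gamma(E^* )$. An anchored vector bundle $(E,\rho)$ has a vector bundle morphism $\rho:E\to T(M)$ over the identity. An almost-Leibniz algebroid $(E,\rho,[\cdot,\cdot]_E)$ is an anchored vector bundle with an $\mathbb{R}$-bilinear bracket on $\mathfrak{X}(E)$ satisfying $[u,fv]_E=\rho(u)(f)v+f[u,v]_E$ for $f\in C^\infty(M,\mathbb{R})$. A local almost-Leibniz algebroid $(E,\rho,[\cdot,\cdot]_E,L)$ is an almost-Leibniz algebroid with a $C^\infty(M,\mathbb{R})$-multilinear map $L:\Omega^1(E)\times\mathfrak{X}(E)\times\mathfrak{X}(E)\to\mathfrak{X}(E)$ (the locality operator) such that $[fu,v]_E=-\rho(v)(f)u+f[u,v]_E+L(Df,u,v)$, where $(Df)(u):=\rho(u)(f)$. An almost-dull algebroid is an anchored vector bundle $(E,\rho)$ with a bracket on $\mathfrak{X}(E)$ satisfying $[f_1u,f_2v]=f_1f_2[u,v]+f_1\rho(u)(f_2)v-f_2\rho(v)(f_1)u$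 for all functions $f_1,f_2$ and sections $u,v$ (equivalently a local almost-Leibniz algebroid with zero locality operator). An almost-Lie algebroid is an almost-Leibniz algebroid whose bracket is anti-symmetric. A linear $E$-connection is an $\mathbb{R}$-bilinear map $\nabla:\mathfrak{X}(E)\times\mathfrak{X}(E)\to\mathfrak{X}(E)$ with $\nabla_u(fv)=\rho(u)(f)v+f\nabla_uv$ and $\nabla_{fu}v=f\nabla_uv$. $(X_a)$ denotes a local frame of $E$, $(e^a)$ the dual coframe, repeated indices are summed; $L(e^a,\nabla_{X_a}u,v)$ does not depend on the frame. $\nabla$ is admissible if $[u,v]_E+[v,u]_E=L(e^a,\nabla_{X_a}u,v)+L(e^a,\nabla_{X_a}v,u)$ for all $u,v\in\mathfrak{X}(E)$. *)

theory Defs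
  imports "HOL-Analysis.Analysis"
begin

section \<open>Smooth maps on open subsets of normed spaces\<close>

text \<open>
  On an open subset of a finite-dimensional space, being \<open>n + 1\<close> times continuously differentiable
  is the same as being differentiable with all directional derivatives \<open>n\<close> times
  continuously differentiable.
\<close>

primrec Ck_on :: "nat \<Rightarrow> 'a::real_normed_vector set \<Rightarrow> ('a \<Rightarrow> 'b::real_normed_vector) \<Rightarrow> bool" where
  "Ck_on 0 S f \<longleftrightarrow> continuous_on S f"
| "Ck_on (Suc n) S f \<longleftrightarrow>
     (\<forall>x\<in>S. f differentiable (at x)) \<and> (\<forall>h. Ck_on n S (\<lambda>x. frechet_derivative f (at x) h))"

definition smooth_on :: "'a::real_normed_vector set \<Rightarrow> ('a \<Rightarrow> 'b::real_normed_vector) \<Rightarrow> bool" where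
  "smooth_on S f \<longleftrightarrow> (\<forall>n. Ck_on n S f)"


section \<open>Smooth manifolds\<close>

text \<open>
  The manifold is the type \<open>'m\<close> itself, so that functions on the manifold are functions on
  \<open>'m\<close>.  The model space ranges over all finite-dimensional inner product spaces: for a normed space,
  the class \<open>heine_borel\<close> amounts to finite dimension.  Unlike \<open>euclidean_space\<close>, this
  sort admits the zero space, hence zero-dimensional manifolds.  A chart is a pair of its domain
  and its coordinate map; values of the coordinate map outside the domain are irrelevant.
\<close>

locale smooth_manifold =
  fixes charts :: "('m::{t2_space,second_countable_topology} set
                    \<times> ('m \<Rightarrow> 'c::{real_inner,heine_borel})) set"
  assumes charts_cover: "(\<Union>(U, \<phi>)\<in>charts. U) = UNIV"
    and chart_open: "(U, \<phi>) \<in> charts \<Longrightarrow> open U \<and> open (\<phi> ` U)"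
    and chart_homeomorphism: "(U, \<phi>) \<in> charts \<Longrightarrow> homeomorphism U (\<phi> ` U) \<phi> (inv_into U \<phi>)"
    and chart_transition: "(U, \<phi>) \<in> charts \<Longrightarrow> (V, \<psi>) \<in> charts
          \<Longrightarrow> smooth_on (\<phi> ` (U \<inter> V)) (\<psi> \<circ> inv_into U \<phi>)"
begin

text \<open>Smoothness on an open set \<open>W\<close>.\<close>

definition smooth_fun_on :: "'m set \<Rightarrow> ('m \<Rightarrow> real) \<Rightarrow> bool" where
  "smooth_fun_on W f \<longleftrightarrow> (\<forall>(U, \<phi>)\<in>charts. smooth_on (\<phi> ` (U \<inter> W)) (f \<circ> inv_into U \<phi>))"

definition smooth_functions :: "('m \<Rightarrow> real) set" where
  "smooth_functions = {f. smooth_fun_on UNIV f}"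

text \<open>
  Tangent vectors at \<open>p\<close> are the derivations at \<open>p\<close> of the algebra of smooth functions.  They are
  extended by \<open>0\<close> to nonsmooth functions, so that equality of tangent vectors is equality in HOL.
\<close>

definition tangent_space :: "'m \<Rightarrow> (('m \<Rightarrow> real) \<Rightarrow> real) set" where
  "tangent_space p = {D.
     (\<forall>f\<in>smooth_functions. \<forall>g\<in>smooth_functions. D (\<lambda>q. f q + g q) = D f + D g) \<and>
     (\<forall>f\<in>smooth_functions. \<forall>r. D (\<lambda>q. r * f q) = r * D f) \<and>
     (\<forall>f\<in>smooth_functions. \<forall>g\<in>smooth_functions. D (\<lambda>q. f q * g q) = f p * D g + g p * D f) \<and>
     (\<forall>f. f \<notin> smooth_functions \<longrightarrow> D f = 0)}"

text \<open>
  A section of the tangent bundle over an open set is smooth iff it maps smooth functions to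
  smooth functions; this is how the smooth structure of the tangent bundle enters.
\<close>

definition smooth_vector_field_on :: "'m set \<Rightarrow> ('m \<Rightarrow> ('m \<Rightarrow> real) \<Rightarrow> real) \<Rightarrow> bool" where
  "smooth_vector_field_on W X \<longleftrightarrow>
     (\<forall>p\<in>W. X p \<in> tangent_space p) \<and> (\<forall>f\<in>smooth_functions. smooth_fun_on W (\<lambda>p. X p f))"

end


section \<open>Vector bundles\<close>

text \<open>The space of \<open>k\<close>-tuples of reals, with \<open>k = 0\<close> allowed.\<close>

definition tuples :: "nat \<Rightarrow> (nat \<Rightarrow> real) set" where
  "tuples k = {c. \<forall>i\<ge>k. c i = 0}"

text \<open>
  \<open>E p\<close> is the fibre over \<open>p\<close>.  The fibres are subspaces of one real vector space \<open>'v\<close>, which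
  only serves as a common carrier of their linear structures (any family of vector spaces
  embeds fibrewise in its direct sum): the smooth structure of the bundle is given by the
  trivializations alone, and they are not related to any structure on \<open>'v\<close>.  A local
  trivialization over \<open>U\<close> is a family of linear isomorphisms \<open>\<theta> p\<close> from \<open>E p\<close> to the
  \<open>rank\<close>-tuples, for \<open>p \<in> U\<close>; the transition functions, which are matrix-valued, are required to be smooth.
\<close>

locale vector_bundle = smooth_manifold charts
  for charts :: "('m::{t2_space,second_countable_topology} set
                  \<times> ('m \<Rightarrow> 'c::{real_inner,heine_borel})) set" +
  fixes E :: "'m \<Rightarrow> 'v::real_vector set"
    and rank :: nat
    and trivs :: "('m set \<times> ('m \<Rightarrow> 'v \<Rightarrow> nat \<Rightarrow> real)) set"
  assumes fibre_subspace: "subspace (E p)"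
    and trivs_cover: "(\<Union>(U, \<theta>)\<in>trivs. U) = UNIV"
    and triv_open: "(U, \<theta>) \<in> trivs \<Longrightarrow> open U"
    and triv_bij: "(U, \<theta>) \<in> trivs \<Longrightarrow> p \<in> U \<Longrightarrow> bij_betw (\<theta> p) (E p) (tuples rank)"
    and triv_add: "(U, \<theta>) \<in> trivs \<Longrightarrow> p \<in> U \<Longrightarrow> x \<in> E p \<Longrightarrow> y \<in> E p
          \<Longrightarrow> \<theta> p (x + y) i = \<theta> p x i + \<theta> p y i"
    and triv_scale: "(U, \<theta>) \<in> trivs \<Longrightarrow> p \<in> U \<Longrightarrow> x \<in> E p
          \<Longrightarrow> \<theta> p (r *\<^sub>R x) i = r * \<theta> p x i"
    and triv_transition: "(U, \<theta>) \<in> trivs \<Longrightarrow> (V, \<eta>) \<in> trivs \<Longrightarrow> c \<in> tuples rank \<Longrightarrow> i < rank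
          \<Longrightarrow> smooth_fun_on (U \<inter> V) (\<lambda>p. \<eta> p (inv_into (E p) (\<theta> p) c) i)"
begin

definition section_on :: "'m set \<Rightarrow> ('m \<Rightarrow> 'v) \<Rightarrow> bool" where
  "section_on W u \<longleftrightarrow> (\<forall>p\<in>W. u p \<in> E p) \<and>
     (\<forall>(U, \<theta>)\<in>trivs. \<forall>i<rank. smooth_fun_on (U \<inter> W) (\<lambda>p. \<theta> p (u p) i))"

definition sections :: "('m \<Rightarrow> 'v) set" where
  "sections = {u. section_on UNIV u}"

text \<open>Functionals on a fibre are extended by \<open>0\<close> outside the fibre, again to make equality the right one.\<close>

definition dual_fibre :: "'m \<Rightarrow> ('v \<Rightarrow> real) set" where
  "dual_fibre p = {l.
     (\<forall>x\<in>E p. \<forall>y\<in>E p. l (x + y) = l x + l y) \<and>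
     (\<forall>x\<in>E p. \<forall>r. l (r *\<^sub>R x) = r * l x) \<and>
     (\<forall>x. x \<notin> E p \<longrightarrow> l x = 0)}"

definition form_on :: "'m set \<Rightarrow> ('m \<Rightarrow> 'v \<Rightarrow> real) \<Rightarrow> bool" where
  "form_on W \<omega> \<longleftrightarrow> (\<forall>p\<in>W. \<omega> p \<in> dual_fibre p) \<and>
     (\<forall>(U, \<theta>)\<in>trivs. \<forall>c\<in>tuples rank. smooth_fun_on (U \<inter> W) (\<lambda>p. \<omega> p (inv_into (E p) (\<theta> p) c)))"

definition forms :: "('m \<Rightarrow> 'v \<Rightarrow> real) set" where
  "forms = {\<omega>. form_on UNIV \<omega>}"

definition local_frame :: "'m set \<Rightarrow> (nat \<Rightarrow> 'm \<Rightarrow> 'v) \<Rightarrow> bool" where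
  "local_frame W X \<longleftrightarrow> open W \<and> (\<forall>a<rank. section_on W (X a)) \<and>
     (\<forall>p\<in>W. inj_on (\<lambda>a. X a p) {..<rank} \<and> independent ((\<lambda>a. X a p) ` {..<rank}) \<and>
            span ((\<lambda>a. X a p) ` {..<rank}) = E p)"

definition dual_coframe :: "'m set \<Rightarrow> (nat \<Rightarrow> 'm \<Rightarrow> 'v) \<Rightarrow> (nat \<Rightarrow> 'm \<Rightarrow> 'v \<Rightarrow> real) \<Rightarrow> bool" where
  "dual_coframe W X e \<longleftrightarrow> (\<forall>a<rank. form_on W (e a)) \<and>
     (\<forall>p\<in>W. \<forall>a<rank. \<forall>b<rank. e a p (X b p) = (if a = b then 1 else 0))"

definition real_bilinear :: "(('m \<Rightarrow> 'v) \<Rightarrow> ('m \<Rightarrow> 'v) \<Rightarrow> ('m \<Rightarrow> 'v)) \<Rightarrow> bool" where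
  "real_bilinear B \<longleftrightarrow>
     (\<forall>u\<in>sections. \<forall>v\<in>sections. B u v \<in> sections) \<and>
     (\<forall>u\<in>sections. \<forall>v\<in>sections. \<forall>w\<in>sections.
        B (\<lambda>p. u p + v p) w = (\<lambda>p. B u w p + B v w p) \<and>
        B w (\<lambda>p. u p + v p) = (\<lambda>p. B w u p + B w v p)) \<and>
     (\<forall>u\<in>sections. \<forall>v\<in>sections. \<forall>r.
        B (\<lambda>p. r *\<^sub>R u p) v = (\<lambda>p. r *\<^sub>R B u v p) \<and>
        B u (\<lambda>p. r *\<^sub>R v p) = (\<lambda>p. r *\<^sub>R B u v p))"

text \<open>
  The section \<open>L(e\<^sup>a, \<nabla>\<^bsub>X\<^sub>a\<^esub> u, v)\<close>, summed over \<open>a\<close>.  Since \<open>L\<close> and \<open>\<nabla>\<close> act on global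
  sections while \<open>X\<close> and \<open>e\<close> live on a neighbourhood \<open>W\<close> of \<open>p\<close> only, the value at \<open>p\<close> is computed,
  as usual for operators that are function-linear in the slot in question, from global
  sections \<open>X'\<close>, \<open>e'\<close> that agree with \<open>X\<close>, \<open>e\<close> near \<open>p\<close>.  The definite description denotes the
  common value for all frames and extensions.
\<close>

definition contraction ::
  "(('m \<Rightarrow> 'v \<Rightarrow> real) \<Rightarrow> ('m \<Rightarrow> 'v) \<Rightarrow> ('m \<Rightarrow> 'v) \<Rightarrow> ('m \<Rightarrow> 'v)) \<Rightarrow>
   (('m \<Rightarrow> 'v) \<Rightarrow> ('m \<Rightarrow> 'v) \<Rightarrow> ('m \<Rightarrow> 'v)) \<Rightarrow> ('m \<Rightarrow> 'v) \<Rightarrow> ('m \<Rightarrow> 'v) \<Rightarrow> ('m \<Rightarrow> 'v)" where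
  "contraction L nabla u v = (\<lambda>p. THE y. \<exists>W X e X' e'.
     p \<in> W \<and> local_frame W X \<and> dual_coframe W X e \<and>
     (\<forall>a<rank. X' a \<in> sections \<and> (\<forall>\<^sub>F q in nhds p. X' a q = X a q)) \<and>
     (\<forall>a<rank. e' a \<in> forms \<and> (\<forall>\<^sub>F q in nhds p. e' a q = e a q)) \<and>
     y = (\<Sum>a<rank. L (e' a) (nabla (X' a) u) v p))"

definition modified_bracket ::
  "(('m \<Rightarrow> 'v) \<Rightarrow> ('m \<Rightarrow> 'v) \<Rightarrow> ('m \<Rightarrow> 'v)) \<Rightarrow>
   (('m \<Rightarrow> 'v \<Rightarrow> real) \<Rightarrow> ('m \<Rightarrow> 'v) \<Rightarrow> ('m \<Rightarrow> 'v) \<Rightarrow> ('m \<Rightarrow> 'v)) \<Rightarrow>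
   (('m \<Rightarrow> 'v) \<Rightarrow> ('m \<Rightarrow> 'v) \<Rightarrow> ('m \<Rightarrow> 'v)) \<Rightarrow> ('m \<Rightarrow> 'v) \<Rightarrow> ('m \<Rightarrow> 'v) \<Rightarrow> ('m \<Rightarrow> 'v)" where
  "modified_bracket bracket L nabla u v = (\<lambda>p. bracket u v p - contraction L nabla u v p)"

end


section \<open>Algebroids\<close>

text \<open>
  The anchor is fibrewise linear over the identity; being linear on fibres, it is smooth iff it is
  smooth on the constant sections of every local trivialization.
\<close>

locale anchored_vector_bundle = vector_bundle charts E rank trivs
  for charts :: "('m::{t2_space,second_countable_topology} set
                  \<times> ('m \<Rightarrow> 'c::{real_inner,heine_borel})) set"
    and E :: "'m \<Rightarrow> 'v::real_vector set"
    and rank :: nat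
    and trivs :: "('m set \<times> ('m \<Rightarrow> 'v \<Rightarrow> nat \<Rightarrow> real)) set" +
  fixes \<rho> :: "'m \<Rightarrow> 'v \<Rightarrow> ('m \<Rightarrow> real) \<Rightarrow> real"
  assumes anchor_tangent: "x \<in> E p \<Longrightarrow> \<rho> p x \<in> tangent_space p"
    and anchor_add: "x \<in> E p \<Longrightarrow> y \<in> E p \<Longrightarrow> \<rho> p (x + y) = (\<lambda>f. \<rho> p x f + \<rho> p y f)"
    and anchor_scale: "x \<in> E p \<Longrightarrow> \<rho> p (r *\<^sub>R x) = (\<lambda>f. r * \<rho> p x f)"
    and anchor_smooth: "(U, \<theta>) \<in> trivs \<Longrightarrow> c \<in> tuples rank
          \<Longrightarrow> smooth_vector_field_on U (\<lambda>p. \<rho> p (inv_into (E p) (\<theta> p) c))"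
begin

definition anchor_action :: "('m \<Rightarrow> 'v) \<Rightarrow> ('m \<Rightarrow> real) \<Rightarrow> ('m \<Rightarrow> real)" where
  "anchor_action u f = (\<lambda>p. \<rho> p (u p) f)"

definition D :: "('m \<Rightarrow> real) \<Rightarrow> ('m \<Rightarrow> 'v \<Rightarrow> real)" where
  "D f = (\<lambda>p x. if x \<in> E p then \<rho> p x f else 0)"

end

locale almost_leibniz_algebroid = anchored_vector_bundle charts E rank trivs \<rho>
  for charts :: "('m::{t2_space,second_countable_topology} set
                  \<times> ('m \<Rightarrow> 'c::{real_inner,heine_borel})) set"
    and E :: "'m \<Rightarrow> 'v::real_vector set"
    and rank :: nat
    and trivs :: "('m set \<times> ('m \<Rightarrow> 'v \<Rightarrow> nat \<Rightarrow> real)) set"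
    and \<rho> :: "'m \<Rightarrow> 'v \<Rightarrow> ('m \<Rightarrow> real) \<Rightarrow> real" +
  fixes bracket :: "('m \<Rightarrow> 'v) \<Rightarrow> ('m \<Rightarrow> 'v) \<Rightarrow> ('m \<Rightarrow> 'v)"
  assumes bracket_bilinear: "real_bilinear bracket"
    and bracket_right_leibniz: "u \<in> sections \<Longrightarrow> v \<in> sections \<Longrightarrow> f \<in> smooth_functions
          \<Longrightarrow> bracket u (\<lambda>p. f p *\<^sub>R v p)
              = (\<lambda>p. anchor_action u f p *\<^sub>R v p + f p *\<^sub>R bracket u v p)"

locale local_almost_leibniz_algebroid = almost_leibniz_algebroid charts E rank trivs \<rho> bracket
  for charts :: "('m::{t2_space,second_countable_topology} set
                  \<times> ('m \<Rightarrow> 'c::{real_inner,heine_borel})) set"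
    and E :: "'m \<Rightarrow> 'v::real_vector set"
    and rank :: nat
    and trivs :: "('m set \<times> ('m \<Rightarrow> 'v \<Rightarrow> nat \<Rightarrow> real)) set"
    and \<rho> :: "'m \<Rightarrow> 'v \<Rightarrow> ('m \<Rightarrow> real) \<Rightarrow> real"
    and bracket :: "('m \<Rightarrow> 'v) \<Rightarrow> ('m \<Rightarrow> 'v) \<Rightarrow> ('m \<Rightarrow> 'v)" +
  fixes L :: "('m \<Rightarrow> 'v \<Rightarrow> real) \<Rightarrow> ('m \<Rightarrow> 'v) \<Rightarrow> ('m \<Rightarrow> 'v) \<Rightarrow> ('m \<Rightarrow> 'v)"
  assumes L_closed: "\<omega> \<in> forms \<Longrightarrow> u \<in> sections \<Longrightarrow> v \<in> sections \<Longrightarrow> L \<omega> u v \<in> sections"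
    and L_add1: "\<omega> \<in> forms \<Longrightarrow> \<eta> \<in> forms \<Longrightarrow> u \<in> sections \<Longrightarrow> v \<in> sections
          \<Longrightarrow> L (\<lambda>p x. \<omega> p x + \<eta> p x) u v = (\<lambda>p. L \<omega> u v p + L \<eta> u v p)"
    and L_add2: "\<omega> \<in> forms \<Longrightarrow> u \<in> sections \<Longrightarrow> w \<in> sections \<Longrightarrow> v \<in> sections
          \<Longrightarrow> L \<omega> (\<lambda>p. u p + w p) v = (\<lambda>p. L \<omega> u v p + L \<omega> w v p)"
    and L_add3: "\<omega> \<in> forms \<Longrightarrow> u \<in> sections \<Longrightarrow> v \<in> sections \<Longrightarrow> w \<in> sections
          \<Longrightarrow> L \<omega> u (\<lambda>p. v p + w p) = (\<lambda>p. L \<omega> u v p + L \<omega> u w p)"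
    and L_scale1: "f \<in> smooth_functions \<Longrightarrow> \<omega> \<in> forms \<Longrightarrow> u \<in> sections \<Longrightarrow> v \<in> sections
          \<Longrightarrow> L (\<lambda>p x. f p * \<omega> p x) u v = (\<lambda>p. f p *\<^sub>R L \<omega> u v p)"
    and L_scale2: "f \<in> smooth_functions \<Longrightarrow> \<omega> \<in> forms \<Longrightarrow> u \<in> sections \<Longrightarrow> v \<in> sections
          \<Longrightarrow> L \<omega> (\<lambda>p. f p *\<^sub>R u p) v = (\<lambda>p. f p *\<^sub>R L \<omega> u v p)"
    and L_scale3: "f \<in> smooth_functions \<Longrightarrow> \<omega> \<in> forms \<Longrightarrow> u \<in> sections \<Longrightarrow> v \<in> sections
          \<Longrightarrow> L \<omega> u (\<lambda>p. f p *\<^sub>R v p) = (\<lambda>p. f p *\<^sub>R L \<omega> u v p)"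
    and bracket_left_leibniz: "u \<in> sections \<Longrightarrow> v \<in> sections \<Longrightarrow> f \<in> smooth_functions
          \<Longrightarrow> bracket (\<lambda>p. f p *\<^sub>R u p) v
              = (\<lambda>p. - (anchor_action v f p *\<^sub>R u p) + f p *\<^sub>R bracket u v p + L (D f) u v p)"

locale almost_dull_algebroid = anchored_vector_bundle charts E rank trivs \<rho>
  for charts :: "('m::{t2_space,second_countable_topology} set
                  \<times> ('m \<Rightarrow> 'c::{real_inner,heine_borel})) set"
    and E :: "'m \<Rightarrow> 'v::real_vector set"
    and rank :: nat
    and trivs :: "('m set \<times> ('m \<Rightarrow> 'v \<Rightarrow> nat \<Rightarrow> real)) set"
    and \<rho> :: "'m \<Rightarrow> 'v \<Rightarrow> ('m \<Rightarrow> real) \<Rightarrow> real" +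
  fixes bracket :: "('m \<Rightarrow> 'v) \<Rightarrow> ('m \<Rightarrow> 'v) \<Rightarrow> ('m \<Rightarrow> 'v)"
  assumes dull_bilinear: "real_bilinear bracket"
    and dull_leibniz: "u \<in> sections \<Longrightarrow> v \<in> sections
          \<Longrightarrow> f\<^sub>1 \<in> smooth_functions \<Longrightarrow> f\<^sub>2 \<in> smooth_functions
          \<Longrightarrow> bracket (\<lambda>p. f\<^sub>1 p *\<^sub>R u p) (\<lambda>p. f\<^sub>2 p *\<^sub>R v p)
              = (\<lambda>p. (f\<^sub>1 p * f\<^sub>2 p) *\<^sub>R bracket u v p + (f\<^sub>1 p * anchor_action u f\<^sub>2 p) *\<^sub>R v p
                     - (f\<^sub>2 p * anchor_action v f\<^sub>1 p) *\<^sub>R u p)"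

locale almost_lie_algebroid = almost_leibniz_algebroid charts E rank trivs \<rho> bracket
  for charts :: "('m::{t2_space,second_countable_topology} set
                  \<times> ('m \<Rightarrow> 'c::{real_inner,heine_borel})) set"
    and E :: "'m \<Rightarrow> 'v::real_vector set"
    and rank :: nat
    and trivs :: "('m set \<times> ('m \<Rightarrow> 'v \<Rightarrow> nat \<Rightarrow> real)) set"
    and \<rho> :: "'m \<Rightarrow> 'v \<Rightarrow> ('m \<Rightarrow> real) \<Rightarrow> real"
    and bracket :: "('m \<Rightarrow> 'v) \<Rightarrow> ('m \<Rightarrow> 'v) \<Rightarrow> ('m \<Rightarrow> 'v)" +
  assumes bracket_antisymmetric: "u \<in> sections \<Longrightarrow> v \<in> sections
          \<Longrightarrow> bracket u v = (\<lambda>p. - bracket v u p)"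


section \<open>Connections\<close>

locale linear_connection = anchored_vector_bundle charts E rank trivs \<rho>
  for charts :: "('m::{t2_space,second_countable_topology} set
                  \<times> ('m \<Rightarrow> 'c::{real_inner,heine_borel})) set"
    and E :: "'m \<Rightarrow> 'v::real_vector set"
    and rank :: nat
    and trivs :: "('m set \<times> ('m \<Rightarrow> 'v \<Rightarrow> nat \<Rightarrow> real)) set"
    and \<rho> :: "'m \<Rightarrow> 'v \<Rightarrow> ('m \<Rightarrow> real) \<Rightarrow> real" +
  fixes nabla :: "('m \<Rightarrow> 'v) \<Rightarrow> ('m \<Rightarrow> 'v) \<Rightarrow> ('m \<Rightarrow> 'v)"
  assumes nabla_bilinear: "real_bilinear nabla"
    and nabla_leibniz: "u \<in> sections \<Longrightarrow> v \<in> sections \<Longrightarrow> f \<in> smooth_functions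
          \<Longrightarrow> nabla u (\<lambda>p. f p *\<^sub>R v p)
              = (\<lambda>p. anchor_action u f p *\<^sub>R v p + f p *\<^sub>R nabla u v p)"
    and nabla_tensorial: "u \<in> sections \<Longrightarrow> v \<in> sections \<Longrightarrow> f \<in> smooth_functions
          \<Longrightarrow> nabla (\<lambda>p. f p *\<^sub>R u p) v = (\<lambda>p. f p *\<^sub>R nabla u v p)"

definition (in vector_bundle) admissible ::
  "(('m \<Rightarrow> 'v) \<Rightarrow> ('m \<Rightarrow> 'v) \<Rightarrow> ('m \<Rightarrow> 'v)) \<Rightarrow>
   (('m \<Rightarrow> 'v \<Rightarrow> real) \<Rightarrow> ('m \<Rightarrow> 'v) \<Rightarrow> ('m \<Rightarrow> 'v) \<Rightarrow> ('m \<Rightarrow> 'v)) \<Rightarrow>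
   (('m \<Rightarrow> 'v) \<Rightarrow> ('m \<Rightarrow> 'v) \<Rightarrow> ('m \<Rightarrow> 'v)) \<Rightarrow> bool" where
  "admissible bracket L nabla \<longleftrightarrow> (\<forall>u\<in>sections. \<forall>v\<in>sections.
     (\<lambda>p. bracket u v p + bracket v u p)
     = (\<lambda>p. contraction L nabla u v p + contraction L nabla v u p))"

end

theory Submission
  imports Defs
begin

text \<open>
  The contraction is, near every point, the finite sum
  \<open>\<Sum>\<^sub>a L(e\<^sup>a, \<nabla>\<^bsub>X\<^sub>a\<^esub> u, v)\<close> for global sections \<open>X\<^sub>a\<close> and forms \<open>e\<^sup>a\<close> with
  \<open>\<Sum>\<^sub>a e\<^sup>a(x) X\<^sub>a = x\<close> near that point; these are cut off from a trivialization by a bump function.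
  Function-linearity makes every operator involved local, hence the sum independent of the choice
  and a smooth section.  Replacing \<open>u\<close> by \<open>f u\<close> adds \<open>\<Sum>\<^sub>a \<rho>(X\<^sub>a)(f) L(e\<^sup>a, u, v) = L(D f, u, v)\<close>,
  which is exactly the locality term in the left Leibniz rule of the bracket, so the difference
  satisfies the Leibniz rule without it.
\<close>

section \<open>Smooth real functions and bump functions\<close>

text \<open>The obstacle is that \<open>L\<close> and \<open>nabla\<close> accept global arguments
  only, while frames exist locally. A cut-off frame stops being a frame away from the point, so
  arguments are phrased through the resolution of the identity that survives near it. Comparing two
  such resolutions then requires no inverse of a transition matrix: one matrix
  \<open>e a q (Y b q)\<close> expresses both the sections of one family and the forms of the other.
  As \<open>nabla\<close> is function-linear in its first slot, neither this matrix nor a cut-off is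
  ever differentiated. The bump function has to be built from the recursive notion
  \<open>Ck_on\<close>. Taking it to be a function of the squared norm in a chart limits the
  calculus to bounded bilinear products and composition with a function of one real
  variable.\<close>

lemma Ck_on_subset: "Ck_on n S f \<Longrightarrow> T \<subseteq> S \<Longrightarrow> Ck_on n T f"
  by (induction n arbitrary: f) (auto intro: continuous_on_subset)

lemma Ck_on_locally:
  assumes "\<And>x. x \<in> S \<Longrightarrow> \<exists>T. open T \<and> x \<in> T \<and> Ck_on n T f"
  shows "Ck_on n S f"
  using assms
proof (induction n arbitrary: f)
  case 0
  show ?case
    unfolding Ck_on.simps
  proof (rule continuous_at_imp_continuous_on, rule ballI)
    fix x assume "x \<in> S"
    with 0 obtain T where "open T" "x \<in> T" "continuous_on T f" by (auto simp: Ball_def)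
    then show "isCont f x" by (simp add: continuous_on_eq_continuous_at)
  qed
next
  case (Suc n)
  show ?case
    unfolding Ck_on.simps
  proof (intro conjI ballI allI)
    fix x assume "x \<in> S"
    with Suc.prems show "f differentiable at x" by fastforce
  next
    fix h
    show "Ck_on n S (\<lambda>x. frechet_derivative f (at x) h)"
      using Suc.prems by (intro Suc.IH) fastforce
  qed
qed

lemma Ck_on_SucD:
  assumes "Ck_on (Suc n) S f" and "x \<in> S"
  shows "(f has_derivative frechet_derivative f (at x)) (at x)"
  using assms by (simp add: frechet_derivative_works)

text \<open>Openness of S turns agreement on S into agreement near each of its points, so the
  derivatives agree too and the induction proceeds.\<close>

lemma Ck_on_cong:
  assumes "open S" and "\<And>x. x \<in> S \<Longrightarrow> f x = g x" and "Ck_on n S f"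
  shows "Ck_on n S g"
  using assms(2,3)
proof (induction n arbitrary: f g)
  case 0
  then show ?case by (simp cong: continuous_on_cong)
next
  case (Suc n)
  have der: "(g has_derivative frechet_derivative f (at x)) (at x)" if "x \<in> S" for x
    using Ck_on_SucD[OF Suc.prems(2) that] assms(1) that Suc.prems(1)
    by (rule has_derivative_transform_within_open)
  then have eq: "frechet_derivative f (at x) = frechet_derivative g (at x)" if "x \<in> S" for x
    using that by (metis frechet_derivative_at)
  show ?case
    unfolding Ck_on.simps
  proof (intro conjI ballI allI)
    fix x assume "x \<in> S"
    then show "g differentiable at x" using der by (auto simp: differentiable_def)
  next
    fix h
    show "Ck_on n S (\<lambda>x. frechet_derivative g (at x) h)"
    proof (rule Suc.IH)
      show "Ck_on n S (\<lambda>x. frechet_derivative f (at x) h)" using Suc.prems(2) by simp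
    qed (simp add: eq)
  qed
qed

text \<open>By uniqueness of derivatives an explicit formula may stand in for the chosen
  \<open>frechet_derivative\<close>; the closure lemmas for products and composites supply such
  formulas.\<close>

lemma Ck_on_SucI:
  assumes "open S" and der: "\<And>x. x \<in> S \<Longrightarrow> (f has_derivative f' x) (at x)"
    and "\<And>h. Ck_on n S (\<lambda>x. f' x h)"
  shows "Ck_on (Suc n) S f"
  unfolding Ck_on.simps
proof (intro conjI ballI allI)
  fix x assume "x \<in> S"
  then show "f differentiable at x" using der by (auto simp: differentiable_def)
next
  fix h
  have "f' x h = frechet_derivative f (at x) h" if "x \<in> S" for x
    using der[OF that] by (metis frechet_derivative_at)
  then show "Ck_on n S (\<lambda>x. frechet_derivative f (at x) h)"
    using assms(3)[of h] by (rule Ck_on_cong[OF assms(1)])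
qed

lemma Ck_on_Suc_imp: "Ck_on (Suc n) S f \<Longrightarrow> Ck_on n S f"
proof (induction n arbitrary: f)
  case 0
  then show ?case
    by (auto intro!: continuous_at_imp_continuous_on differentiable_imp_continuous_within)
next
  case (Suc n)
  from Suc.prems have "\<forall>x\<in>S. f differentiable at x"
    and "Ck_on (Suc n) S (\<lambda>x. frechet_derivative f (at x) h)" for h
    unfolding Ck_on.simps(2)[of "Suc n"] by auto
  then show ?case using Suc.IH unfolding Ck_on.simps(2)[of n S f] by blast
qed

lemma Ck_on_const: "open S \<Longrightarrow> Ck_on n S (\<lambda>x. c)"
proof (induction n arbitrary: c)
  case (Suc n)
  show ?case by (rule Ck_on_SucI[where f' = "\<lambda>x h. 0"]) (use Suc in auto)
qed simp

lemma Ck_on_add: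
  "open S \<Longrightarrow> Ck_on n S f \<Longrightarrow> Ck_on n S g \<Longrightarrow> Ck_on n S (\<lambda>x. f x + g x)"
proof (induction n arbitrary: f g)
  case (Suc n)
  show ?case
  proof (rule Ck_on_SucI[where f' = "\<lambda>x h. frechet_derivative f (at x) h + frechet_derivative g (at x) h", OF Suc.prems(1)])
    fix x assume x: "x \<in> S"
    show "((\<lambda>x. f x + g x) has_derivative
       (\<lambda>h. frechet_derivative f (at x) h + frechet_derivative g (at x) h)) (at x)"
      by (intro has_derivative_add Ck_on_SucD[OF Suc.prems(2) x] Ck_on_SucD[OF Suc.prems(3) x])
  next
    fix h
    show "Ck_on n S (\<lambda>x. frechet_derivative f (at x) h + frechet_derivative g (at x) h)"
      using Suc.prems by (intro Suc.IH) simp_all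
  qed
qed (simp add: continuous_on_add)

text \<open>One product rule serves both for multiplication and for the inner product behind the
  squared norm. Each term of the derivative keeps one undifferentiated factor, whose order must be
  lowered by \<open>Ck_on_Suc_imp\<close> before the induction hypothesis applies.\<close>

lemma (in bounded_bilinear) Ck_on:
  "open S \<Longrightarrow> Ck_on n S f \<Longrightarrow> Ck_on n S g \<Longrightarrow> Ck_on n S (\<lambda>x. prod (f x) (g x))"
proof (induction n arbitrary: f g)
  case 0
  then show ?case by (simp add: continuous_on)
next
  case (Suc n)
  show ?case
  proof (rule Ck_on_SucI[where f' = "\<lambda>x h. prod (f x) (frechet_derivative g (at x) h) + prod (frechet_derivative f (at x) h) (g x)", OF Suc.prems(1)])
    fix x assume x: "x \<in> S"
    show "((\<lambda>x. prod (f x) (g x)) has_derivative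
       (\<lambda>h. prod (f x) (frechet_derivative g (at x) h) + prod (frechet_derivative f (at x) h) (g x))) (at x)"
      by (rule FDERIV[OF Ck_on_SucD[OF Suc.prems(2) x] Ck_on_SucD[OF Suc.prems(3) x]])
  next
    fix h
    show "Ck_on n S (\<lambda>x. prod (f x) (frechet_derivative g (at x) h) + prod (frechet_derivative f (at x) h) (g x))"
      using Suc.prems Ck_on_Suc_imp[OF Suc.prems(2)] Ck_on_Suc_imp[OF Suc.prems(3)]
      by (intro Ck_on_add Suc.IH) auto
  qed
qed

text \<open>Over the reals the derivative of f is multiplication by a number, so the derivative of
  the composite is a product in which f' is again composed with g. The induction hypothesis is
  applied to f', hence the generalization over f.\<close>

lemma Ck_on_compose_real:
  fixes f :: "real \<Rightarrow> real"
  shows "open S \<Longrightarrow> Ck_on n UNIV f \<Longrightarrow> Ck_on n S g \<Longrightarrow> Ck_on n S (\<lambda>x. f (g x))"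
proof (induction n arbitrary: f)
  case 0
  then show ?case by (auto intro: continuous_on_compose2)
next
  case (Suc n)
  show ?case
  proof (rule Ck_on_SucI[where f' = "\<lambda>x h. frechet_derivative g (at x) h * frechet_derivative f (at (g x)) 1", OF Suc.prems(1)])
    fix x assume x: "x \<in> S"
    have f': "(f has_derivative frechet_derivative f (at (g x))) (at (g x))"
      using Ck_on_SucD[OF Suc.prems(2)] by blast
    have "frechet_derivative f (at (g x)) k = k * frechet_derivative f (at (g x)) 1" for k
      using linear_scale[OF has_derivative_linear[OF f'], of k 1] by simp
    then have "(\<lambda>h. frechet_derivative f (at (g x)) (frechet_derivative g (at x) h)) =
        (\<lambda>h. frechet_derivative g (at x) h * frechet_derivative f (at (g x)) 1)"
      by (rule ext)
    then show "((\<lambda>x. f (g x)) has_derivative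
        (\<lambda>h. frechet_derivative g (at x) h * frechet_derivative f (at (g x)) 1)) (at x)"
      using has_derivative_compose[OF Ck_on_SucD[OF Suc.prems(3) x] f'] by (simp only:)
  next
    fix h
    show "Ck_on n S (\<lambda>x. frechet_derivative g (at x) h * frechet_derivative f (at (g x)) 1)"
      using Suc.prems Ck_on_Suc_imp[OF Suc.prems(3)]
      by (intro bounded_bilinear.Ck_on[OF bounded_bilinear_mult]
          Suc.IH[of "\<lambda>y. frechet_derivative f (at y) 1"]) auto
  qed
qed

section \<open>A flat function and a smooth step\<close>

text \<open>The value m = 0 is the classical flat function. The powers are included because
  derivatives are then linear combinations of members of the same family.\<close>

definition flat :: "nat \<Rightarrow> real \<Rightarrow> real" where
  "flat m x = (if x > 0 then inverse x ^ m * exp (- inverse x) else 0)"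

text \<open>Substituting t = 1/x turns the right-hand limit into that of t^m / exp t at infinity; on
  the left the function vanishes.\<close>

lemma flat_tendsto_0: "(flat m \<longlongrightarrow> 0) (at 0)"
proof -
  have "((\<lambda>x. inverse x ^ m * exp (- inverse x)) \<longlongrightarrow> (0::real)) (at_right 0)"
    using filterlim_compose[OF tendsto_power_div_exp_0 filterlim_inverse_at_top_right, of m]
    by (simp add: exp_minus field_simps)
  then have "(flat m \<longlongrightarrow> 0) (at_right 0)"
    by (rule Lim_transform_eventually)
       (auto simp: flat_def eventually_at_right_field intro!: exI[of _ 1])
  moreover have "(flat m \<longlongrightarrow> 0) (at_left 0)"
    by (rule tendsto_eventually) (auto simp: flat_def eventually_at_left_field intro!: exI[of _ "-1"])
  ultimately show ?thesis by (simp add: filterlim_split_at)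
qed

lemma flat_DERIV: "(flat m has_real_derivative (- real m * flat (Suc m) x + flat (Suc (Suc m)) x)) (at x)"
proof -
  consider "x > 0" | "x < 0" | "x = 0" by linarith
  then show ?thesis
  proof cases
    case 1
    have "((\<lambda>x. inverse x ^ m * exp (- inverse x)) has_real_derivative
        (- real m * flat (Suc m) x + flat (Suc (Suc m)) x)) (at x)"
    proof (cases m)
      case (Suc k)
      have "((\<lambda>x. inverse x ^ Suc k * exp (- inverse x)) has_real_derivative
          (1 + real k) * (- (inverse x ^ Suc (Suc 0)) * inverse x ^ k) * exp (- inverse x) +
          exp (- inverse x) * (- (- (inverse x ^ Suc (Suc 0)))) * inverse x ^ Suc k) (at x)"
        by (intro DERIV_mult DERIV_power_Suc DERIV_inverse DERIV_fun_exp DERIV_minus) (use 1 in auto)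
      then show ?thesis
        using 1 unfolding Suc by (simp add: flat_def algebra_simps)
    qed (use 1 in \<open>auto intro!: derivative_eq_intros simp: flat_def\<close>)
    then show ?thesis
      by (rule has_field_derivative_transform_within_open[where S = "{0<..}"])
        (use 1 in \<open>auto simp: flat_def\<close>)
  next
    case 2
    have "((\<lambda>x. 0) has_real_derivative (- real m * flat (Suc m) x + flat (Suc (Suc m)) x)) (at x)"
      using 2 by (simp add: flat_def)
    then show ?thesis
      by (rule has_field_derivative_transform_within_open[where S = "{..<0}"])
        (use 2 in \<open>auto simp: flat_def\<close>)
  next
    case 3
    \<comment> \<open>Since \<open>flat m 0 = 0\<close>, the difference quotient at 0 is
      \<open>flat (Suc m) h\<close>, whose limit is already known.\<close>
    have "((\<lambda>h. (flat m h - flat m 0) / (h - 0)) \<longlongrightarrow> 0) (at 0)"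
      using flat_tendsto_0[of "Suc m"]
      by (rule Lim_transform_eventually) (auto simp: flat_def eventually_at_filter field_simps)
    then show ?thesis
      using 3 by (simp add: has_field_derivative_iff flat_def)
  qed
qed

lemma Ck_on_flat: "Ck_on n UNIV (flat m)"
proof (induction n arbitrary: m)
  case 0
  show ?case
    by (auto intro!: continuous_at_imp_continuous_on DERIV_isCont[OF flat_DERIV])
next
  case (Suc n)
  show ?case
    by (rule Ck_on_SucI[OF open_UNIV flat_DERIV[unfolded has_field_derivative_def]])
      (intro bounded_bilinear.Ck_on[OF bounded_bilinear_mult] Ck_on_add Ck_on_const Suc open_UNIV)
qed

lemma flat_mono: "x \<le> y \<Longrightarrow> flat 0 x \<le> flat 0 y"
  by (auto simp: flat_def)

text \<open>Nesting \<open>flat 0\<close> avoids the usual quotient of smooth functions.\<close>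

lemma smooth_step_exists:
  assumes "0 < (r::real)"
  obtains h :: "real \<Rightarrow> real" and s where "\<And>n. Ck_on n UNIV h" and "0 < s"
    and "\<And>t. t \<le> s \<Longrightarrow> h t = 1" and "\<And>t. r \<le> t \<Longrightarrow> h t = 0"
proof
  define a where "a = r / 2"
  define c where "c = flat 0 (r - a)"
  have "c > 0" using assms by (simp add: c_def a_def flat_def)
  then have pos: "flat 0 c > 0" by (simp add: flat_def)
  \<comment> \<open>Up to a the inner \<open>flat\<close> vanishes and the factor
    \<open>inverse (flat 0 c)\<close> normalizes the value to 1. From r on, monotonicity makes it at
    least c, so the outer argument is at most 0. Differences are written as sums with a multiple of
    -1 to match the rules for \<open>Ck_on\<close>.\<close>
  let ?h = "\<lambda>t. inverse (flat 0 c) * flat 0 (c + (- 1) * flat 0 (t + (- a)))"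
  show "Ck_on n UNIV ?h" for n
  proof -
    have id: "Ck_on n UNIV (\<lambda>t::real. t)"
      by (cases n) (auto intro!: Ck_on_SucI[where f' = "\<lambda>x h. h"] Ck_on_const)
    show ?thesis
      by (intro bounded_bilinear.Ck_on[OF bounded_bilinear_mult] Ck_on_add Ck_on_const open_UNIV
        Ck_on_compose_real[OF _ Ck_on_flat] id)
  qed
  show "0 < a" using assms by (simp add: a_def)
  show "?h t = 1" if "t \<le> a" for t using that pos by (simp add: flat_def)
  show "?h t = 0" if "r \<le> t" for t
    using flat_mono[of "r - a" "t - a"] that by (simp add: c_def flat_def)
qed

section \<open>Smooth functions and bump functions on a manifold\<close>

context smooth_manifold
begin

lemma chart_image_open:
  assumes "(U, \<phi>) \<in> charts" and "open W"
  shows "open (\<phi> ` (U \<inter> W))"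
proof -
  have "openin (top_of_set (\<phi> ` U)) (\<phi> ` (U \<inter> W))"
    using chart_homeomorphism[OF assms(1)]
    by (rule homeomorphism_imp_open_map) (simp add: assms(2) openin_open_Int)
  then show ?thesis using chart_open[OF assms(1)] openin_open_trans by blast
qed

lemma chart_inv: "(U, \<phi>) \<in> charts \<Longrightarrow> p \<in> U \<Longrightarrow> inv_into U \<phi> (\<phi> p) = p"
  using chart_homeomorphism by (meson homeomorphism_apply1)

lemma chart_around: obtains U \<phi> where "(U, \<phi>) \<in> charts" and "p \<in> U"
proof -
  have "p \<in> (\<Union>(U, \<phi>)\<in>charts. U)" by (simp add: charts_cover)
  then show thesis using that by auto
qed

lemma smooth_fun_on_iff:
  "smooth_fun_on W f \<longleftrightarrow> (\<forall>U \<phi> n. (U, \<phi>) \<in> charts \<longrightarrow> Ck_on n (\<phi> ` (U \<inter> W)) (\<lambda>x. f (inv_into U \<phi> x)))"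
  by (auto simp: smooth_fun_on_def smooth_on_def o_def)

lemma smooth_fun_on_subset: "smooth_fun_on W f \<Longrightarrow> V \<subseteq> W \<Longrightarrow> smooth_fun_on V f"
  unfolding smooth_fun_on_iff by (meson Ck_on_subset Int_mono image_mono order_refl)

lemma smooth_fun_on_cong:
  assumes "open W" and "\<And>p. p \<in> W \<Longrightarrow> f p = g p" and "smooth_fun_on W f"
  shows "smooth_fun_on W g"
  unfolding smooth_fun_on_iff
proof (intro allI impI)
  fix U \<phi> n assume U: "(U, \<phi>) \<in> charts"
  have eq: "f (inv_into U \<phi> x) = g (inv_into U \<phi> x)" if "x \<in> \<phi> ` (U \<inter> W)" for x
    using that assms(2) chart_inv[OF U] by auto
  have "Ck_on n (\<phi> ` (U \<inter> W)) (\<lambda>x. f (inv_into U \<phi> x))"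
    using assms(3) U by (simp add: smooth_fun_on_iff)
  with chart_image_open[OF U assms(1)] eq
  show "Ck_on n (\<phi> ` (U \<inter> W)) (\<lambda>x. g (inv_into U \<phi> x))"
    by (rule Ck_on_cong)
qed

lemma smooth_fun_on_locally:
  assumes "\<And>p. p \<in> W \<Longrightarrow> \<exists>N. open N \<and> p \<in> N \<and> smooth_fun_on N f"
  shows "smooth_fun_on W f"
  unfolding smooth_fun_on_iff
proof (intro allI impI)
  fix U \<phi> n assume U: "(U, \<phi>) \<in> charts"
  show "Ck_on n (\<phi> ` (U \<inter> W)) (\<lambda>x. f (inv_into U \<phi> x))"
  proof (rule Ck_on_locally)
    fix x assume "x \<in> \<phi> ` (U \<inter> W)"
    then obtain p where p: "p \<in> U" "p \<in> W" "x = \<phi> p" by auto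
    then obtain N where "open N" "p \<in> N" "smooth_fun_on N f" using assms by blast
    then show "\<exists>T. open T \<and> x \<in> T \<and> Ck_on n T (\<lambda>x. f (inv_into U \<phi> x))"
      using p U chart_image_open[OF U, of N]
      by (intro exI[of _ "\<phi> ` (U \<inter> N)"]) (auto simp: smooth_fun_on_iff)
  qed
qed

lemma smooth_fun_on_const: "open W \<Longrightarrow> smooth_fun_on W (\<lambda>p. c)"
  by (simp add: smooth_fun_on_iff Ck_on_const chart_image_open)

lemma smooth_fun_on_add:
  "open W \<Longrightarrow> smooth_fun_on W f \<Longrightarrow> smooth_fun_on W g \<Longrightarrow> smooth_fun_on W (\<lambda>p. f p + g p)"
  by (simp add: smooth_fun_on_iff Ck_on_add chart_image_open)

lemma smooth_fun_on_mult:
  "open W \<Longrightarrow> smooth_fun_on W f \<Longrightarrow> smooth_fun_on W g \<Longrightarrow> smooth_fun_on W (\<lambda>p. f p * g p)"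
  by (simp add: smooth_fun_on_iff bounded_bilinear.Ck_on[OF bounded_bilinear_mult] chart_image_open)

lemma smooth_fun_on_sum:
  assumes "open W" and "\<And>a. a \<in> A \<Longrightarrow> smooth_fun_on W (f a)"
  shows "smooth_fun_on W (\<lambda>p. \<Sum>a\<in>A. f a p)"
  using assms(2)
  by (induction A rule: infinite_finite_induct)
    (auto intro!: smooth_fun_on_const smooth_fun_on_add assms(1))

lemma smooth_functions_on: "f \<in> smooth_functions \<Longrightarrow> smooth_fun_on W f"
  unfolding smooth_functions_def using smooth_fun_on_subset[of UNIV f W] by simp

lemma const_smooth: "(\<lambda>p. c) \<in> smooth_functions"
  by (simp add: smooth_functions_def smooth_fun_on_const)

text \<open>A smooth step is applied to the squared distance from the image of p in a chart.
  Vanishing outside a closed K inside W says more than vanishing outside W: the open set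
  \<open>- K\<close> then covers the boundary of W, so cut-offs of objects on W extend smoothly by
  zero. Compactness and the Hausdorff property make K closed.\<close>

lemma bump_function_exists:
  assumes "open W" and "p \<in> W"
  obtains \<kappa> N K where "\<kappa> \<in> smooth_functions" and "open N" and "p \<in> N"
    and "\<And>q. q \<in> N \<Longrightarrow> \<kappa> q = 1" and "closed K" and "K \<subseteq> W" and "\<And>q. q \<notin> K \<Longrightarrow> \<kappa> q = 0"
proof -
  obtain U \<phi> where U: "(U, \<phi>) \<in> charts" and p: "p \<in> U" by (rule chart_around)
  note hom = chart_homeomorphism[OF U] and open_U = conjunct1[OF chart_open[OF U]]
  obtain r where "r > 0" and r: "cball (\<phi> p) r \<subseteq> \<phi> ` (U \<inter> W)"
    using chart_image_open[OF U assms(1)] p assms(2)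
    unfolding open_contains_cball by (metis IntI imageI)
  define K where "K = inv_into U \<phi> ` cball (\<phi> p) r"
  have "continuous_on (cball (\<phi> p) r) (inv_into U \<phi>)"
    using homeomorphism_cont2[OF hom] by (rule continuous_on_subset) (use r in auto)
  then have closed_K: "closed K"
    unfolding K_def by (intro compact_imp_closed compact_continuous_image compact_cball)
  have K: "K \<subseteq> U \<inter> W"
    unfolding K_def using r chart_inv[OF U] by fastforce
  obtain h s where h: "\<And>n. Ck_on n UNIV h" and "0 < s"
    and h1: "\<And>t. t \<le> s \<Longrightarrow> h t = 1" and h0: "\<And>t. r\<^sup>2 \<le> t \<Longrightarrow> h t = (0::real)"
    using smooth_step_exists[of "r\<^sup>2"] \<open>r > 0\<close> by auto
  define \<kappa> where "\<kappa> q = (if q \<in> U then h (inner (\<phi> q + - \<phi> p) (\<phi> q + - \<phi> p)) else 0)" for q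
  define N where "N = U \<inter> \<phi> -` ball (\<phi> p) (sqrt s)"
  have \<kappa>0: "\<kappa> q = 0" if "q \<notin> K" for q
  proof (cases "q \<in> U")
    case True
    have "\<phi> q \<notin> cball (\<phi> p) r"
      using that chart_inv[OF U True] unfolding K_def by force
    then have "r\<^sup>2 \<le> (norm (\<phi> q - \<phi> p))\<^sup>2"
      using \<open>r > 0\<close> by (intro power_mono) (auto simp: dist_norm norm_minus_commute)
    then show ?thesis using True h0 by (simp add: \<kappa>_def power2_norm_eq_inner)
  qed (simp add: \<kappa>_def)
  have "smooth_fun_on U \<kappa>"
    unfolding smooth_fun_on_iff
  proof (intro allI impI)
    fix V \<psi> n assume V: "(V, \<psi>) \<in> charts"
    let ?g = "\<lambda>x. \<phi> (inv_into V \<psi> x)"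
    have op: "open (\<psi> ` (V \<inter> U))" using chart_image_open[OF V open_U] .
    \<comment> \<open>Read in another chart, the coordinate map becomes a transition map; this is
      where compatibility of charts enters.\<close>
    have g: "Ck_on n (\<psi> ` (V \<inter> U)) ?g"
      using chart_transition[OF V U] by (simp add: smooth_on_def o_def)
    have "Ck_on n (\<psi> ` (V \<inter> U)) (\<lambda>x. h (inner (?g x + - \<phi> p) (?g x + - \<phi> p)))"
      by (rule Ck_on_compose_real[OF op h])
        (intro bounded_bilinear.Ck_on[OF bounded_bilinear_inner] Ck_on_add g Ck_on_const op)
    then show "Ck_on n (\<psi> ` (V \<inter> U)) (\<lambda>x. \<kappa> (inv_into V \<psi> x))"
      by (rule Ck_on_cong[OF op, rotated]) (auto simp: \<kappa>_def chart_inv[OF V])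
  qed
  \<comment> \<open>Together with U this open set covers the manifold, because K lies in U.\<close>
  moreover have "smooth_fun_on (- K) \<kappa>"
    by (rule smooth_fun_on_cong[OF _ _ smooth_fun_on_const]) (simp_all add: closed_K \<kappa>0 open_Compl)
  ultimately have "\<kappa> \<in> smooth_functions"
    unfolding smooth_functions_def mem_Collect_eq
    using K closed_K open_U by (intro smooth_fun_on_locally) (metis Compl_iff IntD1 open_Compl subsetD)
  moreover have "open N"
    unfolding N_def using homeomorphism_cont1[OF hom] open_U open_ball
    by (rule continuous_open_preimage)
  moreover have "p \<in> N" using p \<open>0 < s\<close> by (simp add: N_def)
  moreover have "\<kappa> q = 1" if "q \<in> N" for q
  proof -
    have "norm (\<phi> q - \<phi> p) \<le> sqrt s" using that by (simp add: N_def dist_norm norm_minus_commute)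
    then have "(norm (\<phi> q - \<phi> p))\<^sup>2 \<le> s" using \<open>0 < s\<close> by (metis norm_ge_zero power_mono real_sqrt_pow2 order_less_imp_le)
    then show ?thesis using that h1 by (simp add: N_def \<kappa>_def power2_norm_eq_inner)
  qed
  ultimately show thesis using that closed_K K \<kappa>0 by blast
qed

end

section \<open>Sections, forms and frames\<close>

context vector_bundle
begin

section \<open>Linear algebra of a trivialization\<close>

lemma triv_around: obtains U \<theta> where "(U, \<theta>) \<in> trivs" and "p \<in> U"
proof -
  have "p \<in> (\<Union>(U, \<theta>)\<in>trivs. U)" by (simp add: trivs_cover)
  then show thesis using that by auto
qed

text \<open>The empty sum is an intended instance: it says that trivializations send 0 to 0.\<close>

lemma triv_sum:
  assumes U: "(U, \<theta>) \<in> trivs" "p \<in> U" and "\<And>a. a \<in> A \<Longrightarrow> x a \<in> E p"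
  shows "\<theta> p (\<Sum>a\<in>A. g a *\<^sub>R x a) i = (\<Sum>a\<in>A. g a * \<theta> p (x a) i)"
  using assms(3)
proof (induction A rule: infinite_finite_induct)
  case (insert a A)
  then show ?case
    by (simp add: triv_add[OF U] triv_scale[OF U] subspace_sum subspace_scale fibre_subspace)
qed (use triv_scale[OF U, of 0 0 i] fibre_subspace in \<open>auto simp: subspace_0\<close>)

definition triv_frame :: "('m \<Rightarrow> 'v \<Rightarrow> nat \<Rightarrow> real) \<Rightarrow> nat \<Rightarrow> 'm \<Rightarrow> 'v" where
  "triv_frame \<theta> a p = inv_into (E p) (\<theta> p) (\<lambda>i. if i = a then 1 else 0)"

text \<open>The value 0 off the fibre is the convention of \<open>dual_fibre\<close>.\<close>

definition triv_coframe :: "('m \<Rightarrow> 'v \<Rightarrow> nat \<Rightarrow> real) \<Rightarrow> nat \<Rightarrow> 'm \<Rightarrow> 'v \<Rightarrow> real" where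
  "triv_coframe \<theta> a p x = (if x \<in> E p then \<theta> p x a else 0)"

lemma unit_tuple: "a < rank \<Longrightarrow> (\<lambda>i. if i = a then 1 else 0) \<in> tuples rank"
  by (auto simp: tuples_def)

lemma triv_inv:
  assumes "(U, \<theta>) \<in> trivs" "p \<in> U" "c \<in> tuples rank"
  shows "inv_into (E p) (\<theta> p) c \<in> E p" and "\<theta> p (inv_into (E p) (\<theta> p) c) = c"
  using triv_bij[OF assms(1,2)] assms(3)
  by (auto simp: bij_betw_def intro: inv_into_into f_inv_into_f)

lemma triv_frame_in: "(U, \<theta>) \<in> trivs \<Longrightarrow> p \<in> U \<Longrightarrow> a < rank \<Longrightarrow> triv_frame \<theta> a p \<in> E p"
  by (simp add: triv_frame_def triv_inv unit_tuple)

lemma triv_of_frame: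
  "(U, \<theta>) \<in> trivs \<Longrightarrow> p \<in> U \<Longrightarrow> a < rank \<Longrightarrow> \<theta> p (triv_frame \<theta> a p) i = (if i = a then 1 else 0)"
  by (simp add: triv_frame_def triv_inv unit_tuple)

lemma triv_expand:
  assumes U: "(U, \<theta>) \<in> trivs" "p \<in> U" and x: "x \<in> E p"
  shows "(\<Sum>a<rank. \<theta> p x a *\<^sub>R triv_frame \<theta> a p) = x"
proof (rule inj_onD[of "\<theta> p" "E p"])
  show "inj_on (\<theta> p) (E p)" using triv_bij[OF U] by (simp add: bij_betw_def)
  show "(\<Sum>a<rank. \<theta> p x a *\<^sub>R triv_frame \<theta> a p) \<in> E p"
    by (intro subspace_sum subspace_scale fibre_subspace triv_frame_in[OF U]) simp
  have "\<theta> p x \<in> tuples rank" using triv_bij[OF U] x by (rule bij_betwE[rule_format])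
  \<comment> \<open>Tuples are functions on all naturals, so the entries from \<open>rank\<close> on
    must be compared as well; both sides are 0 there.\<close>
  then have out: "\<theta> p x i = 0" if "\<not> i < rank" for i
    using that by (simp add: tuples_def)
  show "\<theta> p (\<Sum>a<rank. \<theta> p x a *\<^sub>R triv_frame \<theta> a p) = \<theta> p x"
  proof
    fix i
    have "\<theta> p (\<Sum>a<rank. \<theta> p x a *\<^sub>R triv_frame \<theta> a p) i =
        (\<Sum>a<rank. \<theta> p x a * \<theta> p (triv_frame \<theta> a p) i)"
      by (rule triv_sum[OF U]) (simp add: triv_frame_in[OF U])
    also have "\<dots> = (\<Sum>a<rank. if i = a then \<theta> p x a else 0)"
      by (rule sum.cong) (simp_all add: triv_of_frame[OF U])
    also have "\<dots> = \<theta> p x i" using out by simp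
    finally show "\<theta> p (\<Sum>a<rank. \<theta> p x a *\<^sub>R triv_frame \<theta> a p) i = \<theta> p x i" .
  qed
qed (rule x)

section \<open>Smooth sections\<close>

lemma section_on_iff:
  "section_on W u \<longleftrightarrow> (\<forall>p\<in>W. u p \<in> E p) \<and>
     (\<forall>U \<theta> i. (U, \<theta>) \<in> trivs \<longrightarrow> i < rank \<longrightarrow> smooth_fun_on (U \<inter> W) (\<lambda>p. \<theta> p (u p) i))"
  by (auto simp: section_on_def)

lemma section_on_cong:
  assumes "open W" and "\<And>p. p \<in> W \<Longrightarrow> u p = v p" and "section_on W u"
  shows "section_on W v"
  unfolding section_on_iff
proof (intro conjI ballI allI impI)
  fix U \<theta> i assume U: "(U, \<theta>) \<in> trivs" "i < rank"
  show "smooth_fun_on (U \<inter> W) (\<lambda>p. \<theta> p (v p) i)"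
    by (rule smooth_fun_on_cong[of _ "\<lambda>p. \<theta> p (u p) i"])
      (use assms U in \<open>auto simp: section_on_iff open_Int triv_open\<close>)
qed (use assms in \<open>auto simp: section_on_iff\<close>)

lemma section_on_locally:
  assumes "\<And>p. \<exists>N. open N \<and> p \<in> N \<and> section_on N u"
  shows "u \<in> sections"
  unfolding sections_def mem_Collect_eq section_on_iff
proof (intro conjI ballI allI impI)
  fix p show "u p \<in> E p" using assms by (auto simp: section_on_iff)
next
  fix U \<theta> i assume U: "(U, \<theta>) \<in> trivs" "i < rank"
  show "smooth_fun_on (U \<inter> UNIV) (\<lambda>p. \<theta> p (u p) i)"
  proof (rule smooth_fun_on_locally)
    fix p assume "p \<in> U \<inter> UNIV"
    moreover obtain N where "open N" "p \<in> N" "section_on N u" using assms by blast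
    ultimately show "\<exists>N. open N \<and> p \<in> N \<and> smooth_fun_on N (\<lambda>p. \<theta> p (u p) i)"
      using U triv_open by (intro exI[of _ "U \<inter> N"]) (auto simp: section_on_iff)
  qed
qed

lemma section_on_add:
  assumes "open W" "section_on W u" "section_on W v"
  shows "section_on W (\<lambda>p. u p + v p)"
  unfolding section_on_iff
proof (intro conjI ballI allI impI)
  fix U \<theta> i assume U: "(U, \<theta>) \<in> trivs" "i < rank"
  have "smooth_fun_on (U \<inter> W) (\<lambda>p. \<theta> p (u p) i + \<theta> p (v p) i)"
    using assms U by (intro smooth_fun_on_add) (auto simp: section_on_iff open_Int triv_open)
  then show "smooth_fun_on (U \<inter> W) (\<lambda>p. \<theta> p (u p + v p) i)"
    by (rule smooth_fun_on_cong[rotated 2])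
      (use assms in \<open>auto simp: section_on_iff open_Int triv_open[OF U(1)] triv_add[OF U(1)]\<close>)
qed (use assms fibre_subspace in \<open>auto simp: section_on_iff subspace_add\<close>)

lemma section_on_scale:
  assumes "open W" "smooth_fun_on W f" "section_on W u"
  shows "section_on W (\<lambda>p. f p *\<^sub>R u p)"
  unfolding section_on_iff
proof (intro conjI ballI allI impI)
  fix U \<theta> i assume U: "(U, \<theta>) \<in> trivs" "i < rank"
  have "smooth_fun_on (U \<inter> W) (\<lambda>p. f p * \<theta> p (u p) i)"
    using assms U smooth_fun_on_subset[OF assms(2), of "U \<inter> W"]
    by (intro smooth_fun_on_mult) (auto simp: section_on_iff open_Int triv_open)
  then show "smooth_fun_on (U \<inter> W) (\<lambda>p. \<theta> p (f p *\<^sub>R u p) i)"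
    by (rule smooth_fun_on_cong[rotated 2])
      (use assms in \<open>auto simp: section_on_iff open_Int triv_open[OF U(1)] triv_scale[OF U(1)]\<close>)
qed (use assms fibre_subspace in \<open>auto simp: section_on_iff subspace_scale\<close>)

lemma section_on_zero: "open W \<Longrightarrow> section_on W (\<lambda>p. 0)"
  unfolding section_on_iff
proof (intro conjI ballI allI impI)
  fix U \<theta> i assume "open W" and U: "(U, \<theta>) \<in> trivs" "i < rank"
  have "smooth_fun_on (U \<inter> W) (\<lambda>p. 0)"
    by (intro smooth_fun_on_const open_Int triv_open[OF U(1)] \<open>open W\<close>)
  then show "smooth_fun_on (U \<inter> W) (\<lambda>p. \<theta> p 0 i)"
    by (rule smooth_fun_on_cong[rotated 2])
      (use \<open>open W\<close> triv_sum[OF U(1), of _ "{}"] in \<open>auto simp: open_Int triv_open[OF U(1)]\<close>)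
qed (simp add: fibre_subspace subspace_0)

lemma sections_on: "u \<in> sections \<Longrightarrow> section_on W u"
  unfolding sections_def mem_Collect_eq section_on_iff
  by (meson UNIV_I inf_le1 inf_mono order_refl smooth_fun_on_subset subset_UNIV)

lemma sections_zero: "(\<lambda>p. 0) \<in> sections"
  by (simp add: sections_def section_on_zero)

lemma sections_add: "u \<in> sections \<Longrightarrow> v \<in> sections \<Longrightarrow> (\<lambda>p. u p + v p) \<in> sections"
  by (simp add: sections_def section_on_add)

lemma sections_scale: "f \<in> smooth_functions \<Longrightarrow> u \<in> sections \<Longrightarrow> (\<lambda>p. f p *\<^sub>R u p) \<in> sections"
  by (simp add: sections_def section_on_scale smooth_functions_on)

lemma sections_diff: "u \<in> sections \<Longrightarrow> v \<in> sections \<Longrightarrow> (\<lambda>p. u p - v p) \<in> sections"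
  using sections_add[OF _ sections_scale[OF const_smooth[of "-1"]], of u v] by simp

lemma sections_sum: "(\<And>a. a \<in> A \<Longrightarrow> u a \<in> sections) \<Longrightarrow> (\<lambda>p. \<Sum>a\<in>A. u a p) \<in> sections"
proof (induction A rule: infinite_finite_induct)
  case (insert a A)
  then show ?case using sections_add[of "u a" "\<lambda>p. \<Sum>a\<in>A. u a p"] by simp
qed (simp_all add: sections_zero)

lemma sections_in: "u \<in> sections \<Longrightarrow> u p \<in> E p"
  by (auto simp: sections_def section_on_iff)

text \<open>On W this is a product of smooth objects and on \<open>- K\<close> it is zero; these two
  open sets cover the manifold because K lies in W.\<close>

lemma section_extend:
  assumes "section_on W u" and "open W" and "closed K" and "K \<subseteq> W"
    and "\<kappa> \<in> smooth_functions" and "\<And>q. q \<notin> K \<Longrightarrow> \<kappa> q = 0"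
  shows "(\<lambda>q. \<kappa> q *\<^sub>R u q) \<in> sections"
proof (rule section_on_locally)
  fix p
  have "section_on W (\<lambda>q. \<kappa> q *\<^sub>R u q)"
    by (rule section_on_scale[OF assms(2) smooth_functions_on[OF assms(5)] assms(1)])
  moreover have "section_on (- K) (\<lambda>q. \<kappa> q *\<^sub>R u q)"
    by (rule section_on_cong[OF _ _ section_on_zero]) (simp_all add: assms open_Compl)
  ultimately show "\<exists>N. open N \<and> p \<in> N \<and> section_on N (\<lambda>q. \<kappa> q *\<^sub>R u q)"
    using assms(2-4) by (metis Compl_iff open_Compl subsetD)
qed

section \<open>Smooth forms and their pairing with sections\<close>

lemma dual_fibre_sum:
  assumes "l \<in> dual_fibre p" and "\<And>a. a \<in> A \<Longrightarrow> x a \<in> E p"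
  shows "l (\<Sum>a\<in>A. g a *\<^sub>R x a) = (\<Sum>a\<in>A. g a * l (x a))"
proof -
  have add: "l (x + y) = l x + l y" and scale: "l (r *\<^sub>R x) = r * l x"
    if "x \<in> E p" "y \<in> E p" for x y r
    using assms(1) that by (auto simp: dual_fibre_def)
  show ?thesis
    using assms(2)
  proof (induction A rule: infinite_finite_induct)
    case (insert a A)
    have "(\<Sum>a\<in>A. g a *\<^sub>R x a) \<in> E p"
      using insert.prems by (intro subspace_sum subspace_scale fibre_subspace) auto
    then show ?case
      using insert by (simp add: add scale subspace_scale fibre_subspace)
  qed (use scale[of 0 0 0] subspace_0[OF fibre_subspace] in auto)
qed

lemma form_on_iff:
  "form_on W \<omega> \<longleftrightarrow> (\<forall>p\<in>W. \<omega> p \<in> dual_fibre p) \<and>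
     (\<forall>U \<theta> c. (U, \<theta>) \<in> trivs \<longrightarrow> c \<in> tuples rank \<longrightarrow>
        smooth_fun_on (U \<inter> W) (\<lambda>p. \<omega> p (inv_into (E p) (\<theta> p) c)))"
  by (auto simp: form_on_def)

lemma form_on_cong:
  assumes "open W" and "\<And>p. p \<in> W \<Longrightarrow> \<omega> p = \<eta> p" and "form_on W \<omega>"
  shows "form_on W \<eta>"
  unfolding form_on_iff
proof (intro conjI ballI allI impI)
  fix U \<theta> c assume U: "(U, \<theta>) \<in> trivs" "c \<in> tuples rank"
  show "smooth_fun_on (U \<inter> W) (\<lambda>p. \<eta> p (inv_into (E p) (\<theta> p) c))"
    by (rule smooth_fun_on_cong[of _ "\<lambda>p. \<omega> p (inv_into (E p) (\<theta> p) c)"])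
      (use assms U in \<open>auto simp: form_on_iff open_Int triv_open\<close>)
qed (use assms in \<open>auto simp: form_on_iff\<close>)

lemma form_on_locally:
  assumes "\<And>p. \<exists>N. open N \<and> p \<in> N \<and> form_on N \<omega>"
  shows "\<omega> \<in> forms"
  unfolding forms_def mem_Collect_eq form_on_iff
proof (intro conjI ballI allI impI)
  fix p show "\<omega> p \<in> dual_fibre p" using assms by (auto simp: form_on_iff)
next
  fix U \<theta> c assume U: "(U, \<theta>) \<in> trivs" "c \<in> tuples rank"
  show "smooth_fun_on (U \<inter> UNIV) (\<lambda>p. \<omega> p (inv_into (E p) (\<theta> p) c))"
  proof (rule smooth_fun_on_locally)
    fix p assume "p \<in> U \<inter> UNIV"
    moreover obtain N where "open N" "p \<in> N" "form_on N \<omega>" using assms by blast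
    ultimately show "\<exists>N. open N \<and> p \<in> N \<and> smooth_fun_on N (\<lambda>p. \<omega> p (inv_into (E p) (\<theta> p) c))"
      using U triv_open by (intro exI[of _ "U \<inter> N"]) (auto simp: form_on_iff)
  qed
qed

lemma form_on_add:
  assumes "open W" "form_on W \<omega>" "form_on W \<eta>"
  shows "form_on W (\<lambda>p x. \<omega> p x + \<eta> p x)"
  unfolding form_on_iff
proof (intro conjI ballI allI impI)
  fix U \<theta> c assume "(U, \<theta>) \<in> trivs" "c \<in> tuples rank"
  then show "smooth_fun_on (U \<inter> W)
      (\<lambda>p. \<omega> p (inv_into (E p) (\<theta> p) c) + \<eta> p (inv_into (E p) (\<theta> p) c))"
    using assms by (intro smooth_fun_on_add) (auto simp: form_on_iff open_Int triv_open)
qed (use assms in \<open>auto simp: form_on_iff dual_fibre_def algebra_simps\<close>)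

lemma form_on_scale:
  assumes "open W" "smooth_fun_on W f" "form_on W \<omega>"
  shows "form_on W (\<lambda>p x. f p * \<omega> p x)"
  unfolding form_on_iff
proof (intro conjI ballI allI impI)
  fix U \<theta> c assume "(U, \<theta>) \<in> trivs" "c \<in> tuples rank"
  then show "smooth_fun_on (U \<inter> W) (\<lambda>p. f p * \<omega> p (inv_into (E p) (\<theta> p) c))"
    using assms smooth_fun_on_subset[OF assms(2), of "U \<inter> W"]
    by (intro smooth_fun_on_mult) (auto simp: form_on_iff open_Int triv_open)
qed (use assms in \<open>auto simp: form_on_iff dual_fibre_def algebra_simps\<close>)

lemma form_on_zero: "open W \<Longrightarrow> form_on W (\<lambda>p x. 0)"
  by (auto simp: form_on_iff dual_fibre_def intro!: smooth_fun_on_const open_Int intro: triv_open)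

lemma forms_zero: "(\<lambda>p x. 0) \<in> forms"
  by (simp add: forms_def form_on_zero)

lemma forms_add: "\<omega> \<in> forms \<Longrightarrow> \<eta> \<in> forms \<Longrightarrow> (\<lambda>p x. \<omega> p x + \<eta> p x) \<in> forms"
  by (simp add: forms_def form_on_add)

lemma forms_scale: "f \<in> smooth_functions \<Longrightarrow> \<omega> \<in> forms \<Longrightarrow> (\<lambda>p x. f p * \<omega> p x) \<in> forms"
  by (simp add: forms_def form_on_scale smooth_functions_on)

lemma forms_sum: "(\<And>a. a \<in> A \<Longrightarrow> \<omega> a \<in> forms) \<Longrightarrow> (\<lambda>p x. \<Sum>a\<in>A. \<omega> a p x) \<in> forms"
proof (induction A rule: infinite_finite_induct)
  case (insert a A)
  then show ?case using forms_add[of "\<omega> a" "\<lambda>p x. \<Sum>a\<in>A. \<omega> a p x"] by simp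
qed (simp_all add: forms_zero)

lemma forms_in: "\<omega> \<in> forms \<Longrightarrow> \<omega> p \<in> dual_fibre p"
  by (auto simp: forms_def form_on_iff)

lemma form_extend:
  assumes "form_on W \<omega>" and "open W" and "closed K" and "K \<subseteq> W"
    and "\<kappa> \<in> smooth_functions" and "\<And>q. q \<notin> K \<Longrightarrow> \<kappa> q = 0"
  shows "(\<lambda>q x. \<kappa> q * \<omega> q x) \<in> forms"
proof (rule form_on_locally)
  fix p
  have "form_on W (\<lambda>q x. \<kappa> q * \<omega> q x)"
    by (rule form_on_scale[OF assms(2) smooth_functions_on[OF assms(5)] assms(1)])
  moreover have "form_on (- K) (\<lambda>q x. \<kappa> q * \<omega> q x)"
    by (rule form_on_cong[OF _ _ form_on_zero]) (simp_all add: assms open_Compl)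
  ultimately show "\<exists>N. open N \<and> p \<in> N \<and> form_on N (\<lambda>q x. \<kappa> q * \<omega> q x)"
    using assms(2-4) by (metis Compl_iff open_Compl subsetD)
qed

text \<open>Smoothness of a form is tested only on constant tuples of a trivialization. Expanding s
  in the trivialization frame reduces the pairing to these tests, with the coordinates of s as
  smooth coefficients.\<close>

lemma pairing_smooth:
  assumes \<omega>: "\<omega> \<in> forms" and s: "s \<in> sections"
  shows "(\<lambda>p. \<omega> p (s p)) \<in> smooth_functions"
  unfolding smooth_functions_def mem_Collect_eq
proof (rule smooth_fun_on_locally)
  fix p :: 'm
  obtain U \<theta> where U: "(U, \<theta>) \<in> trivs" and p: "p \<in> U" by (rule triv_around)
  have "smooth_fun_on U (\<lambda>q. \<Sum>a<rank. \<theta> q (s q) a * \<omega> q (triv_frame \<theta> a q))"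
    using \<omega> s U unit_tuple unfolding triv_frame_def sections_def forms_def section_on_iff form_on_iff
    by (intro smooth_fun_on_sum smooth_fun_on_mult triv_open[OF U]) auto
  then have "smooth_fun_on U (\<lambda>q. \<omega> q (s q))"
  proof (rule smooth_fun_on_cong[OF triv_open[OF U], rotated])
    fix q assume q: "q \<in> U"
    show "(\<Sum>a<rank. \<theta> q (s q) a * \<omega> q (triv_frame \<theta> a q)) = \<omega> q (s q)"
      using dual_fibre_sum[OF forms_in[OF \<omega>], of "{..<rank}" "\<lambda>a. triv_frame \<theta> a q" q "\<lambda>a. \<theta> q (s q) a"]
        triv_frame_in[OF U q] triv_expand[OF U q sections_in[OF s]] by simp
  qed
  then show "\<exists>N. open N \<and> p \<in> N \<and> smooth_fun_on N (\<lambda>q. \<omega> q (s q))"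
    using p triv_open[OF U] by blast
qed

section \<open>Local frames and dual coframes\<close>

text \<open>Smoothness of the frame is \<open>triv_transition\<close> at the unit tuples.\<close>

lemma triv_local_frame:
  assumes U: "(U, \<theta>) \<in> trivs"
  shows "local_frame U (triv_frame \<theta>)"
  unfolding local_frame_def
proof (intro conjI ballI allI impI)
  show "open U" using triv_open[OF U] .
next
  fix a assume a: "a < rank"
  show "section_on U (triv_frame \<theta> a)"
    unfolding section_on_iff
  proof (intro conjI ballI allI impI)
    fix V \<eta> i assume "(V, \<eta>) \<in> trivs" "i < rank"
    then show "smooth_fun_on (V \<inter> U) (\<lambda>p. \<eta> p (triv_frame \<theta> a p) i)"
      using triv_transition[OF U _ unit_tuple[OF a]] unfolding triv_frame_def Int_commute[of V]
      by blast
  qed (use triv_frame_in U a in blast)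
next
  fix p assume p: "p \<in> U"
  let ?X = "\<lambda>a. triv_frame \<theta> a p"
  show inj: "inj_on ?X {..<rank}"
  proof (rule inj_onI)
    fix a b assume "a \<in> {..<rank}" "b \<in> {..<rank}" "?X a = ?X b"
    then show "a = b" using triv_of_frame[OF U p, of a a] triv_of_frame[OF U p, of b a]
      by (auto split: if_splits)
  qed
  show "independent (?X ` {..<rank})"
    unfolding dependent_finite[OF finite_imageI[OF finite_lessThan]]
  proof clarify
    fix c a assume a: "a < rank" and "c (?X a) \<noteq> 0" and "(\<Sum>x\<in>?X ` {..<rank}. c x *\<^sub>R x) = 0"
    \<comment> \<open>Taking the a-th coordinate of a vanishing combination isolates its a-th
      coefficient.\<close>
    then have "(\<Sum>b<rank. c (?X b) *\<^sub>R ?X b) = 0" by (simp add: sum.reindex[OF inj])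
    then have "(\<Sum>b<rank. c (?X b) * \<theta> p (?X b) a) = \<theta> p 0 a"
      using triv_sum[OF U p, of "{..<rank}" ?X "\<lambda>b. c (?X b)" a] triv_frame_in[OF U p] by simp
    also have "\<theta> p 0 a = 0" using triv_sum[OF U p, of "{}"] by simp
    finally have "c (?X a) = 0"
      using a by (simp add: triv_of_frame[OF U p] if_distrib sum.delta cong: if_cong)
    with \<open>c (?X a) \<noteq> 0\<close> show False ..
  qed
  show "span (?X ` {..<rank}) = E p"
  proof
    show "span (?X ` {..<rank}) \<subseteq> E p"
      using triv_frame_in[OF U p] fibre_subspace by (intro span_minimal) auto
    show "E p \<subseteq> span (?X ` {..<rank})"
    proof
      fix x assume "x \<in> E p"
      then have "(\<Sum>a<rank. \<theta> p x a *\<^sub>R ?X a) = x" by (rule triv_expand[OF U p])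
      moreover have "(\<Sum>a<rank. \<theta> p x a *\<^sub>R ?X a) \<in> span (?X ` {..<rank})"
        by (intro span_sum span_scale span_base) auto
      ultimately show "x \<in> span (?X ` {..<rank})" by simp
    qed
  qed
qed

lemma triv_dual_coframe:
  assumes U: "(U, \<theta>) \<in> trivs"
  shows "dual_coframe U (triv_frame \<theta>) (triv_coframe \<theta>)"
  unfolding dual_coframe_def
proof (intro conjI ballI allI impI)
  fix a assume a: "a < rank"
  show "form_on U (triv_coframe \<theta> a)"
    unfolding form_on_iff
  proof (intro conjI ballI allI impI)
    fix p assume p: "p \<in> U"
    show "triv_coframe \<theta> a p \<in> dual_fibre p"
      using triv_add[OF U p] triv_scale[OF U p] fibre_subspace[of p]
      by (auto simp: dual_fibre_def triv_coframe_def subspace_add subspace_scale)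
  next
    fix V \<eta> c assume V: "(V, \<eta>) \<in> trivs" "c \<in> tuples rank"
    show "smooth_fun_on (V \<inter> U) (\<lambda>p. triv_coframe \<theta> a p (inv_into (E p) (\<eta> p) c))"
      by (rule smooth_fun_on_cong[OF _ _ triv_transition[OF V(1) U V(2) a]])
        (use triv_open U V triv_inv in \<open>auto simp: triv_coframe_def\<close>)
  qed
next
  fix p a b assume "p \<in> U" "a < rank" "b < rank"
  then show "triv_coframe \<theta> a p (triv_frame \<theta> b p) = (if a = b then 1 else 0)"
    using triv_frame_in[OF U] triv_of_frame[OF U] by (simp add: triv_coframe_def)
qed

text \<open>Spanning provides some coefficients of x, and duality identifies them with the values of
  the coframe on x.\<close>

lemma frame_expand:
  assumes "local_frame W X" "dual_coframe W X e" "p \<in> W" "x \<in> E p"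
  shows "(\<Sum>a<rank. e a p x *\<^sub>R X a p) = x"
proof -
  have span: "span ((\<lambda>a. X a p) ` {..<rank}) = E p"
    using assms(1,3) by (auto simp: local_frame_def)
  have X: "X a p \<in> E p" if "a < rank" for a
    using span that span_base[of "X a p" "(\<lambda>a. X a p) ` {..<rank}"] by auto
  have e: "e a p \<in> dual_fibre p" if "a < rank" for a
    using assms(2,3) that by (auto simp: dual_coframe_def form_on_iff)
  have "x \<in> span ((\<lambda>a. X a p) ` {..<rank})" using span assms(4) by simp
  then obtain h where "x = (\<Sum>y\<in>(\<lambda>a. X a p) ` {..<rank}. h y *\<^sub>R y)"
    by (auto simp: span_finite)
  moreover have "inj_on (\<lambda>a. X a p) {..<rank}" using assms(1,3) by (simp add: local_frame_def)
  ultimately have x: "x = (\<Sum>b<rank. h (X b p) *\<^sub>R X b p)" by (simp add: sum.reindex)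
  have "e a p x = h (X a p)" if "a < rank" for a
  proof -
    have "e a p x = (\<Sum>b<rank. h (X b p) * e a p (X b p))"
      unfolding x by (rule dual_fibre_sum[OF e[OF that]]) (simp add: X)
    also have "\<dots> = (\<Sum>b<rank. if a = b then h (X b p) else 0)"
      using that assms(2,3) by (intro sum.cong) (auto simp: dual_coframe_def)
    finally show ?thesis using that by simp
  qed
  then show ?thesis by (simp add: x)
qed

section \<open>Locality of function-linear operators\<close>

text \<open>Take a bump function \<kappa> supported in N with \<kappa> = 1 at p. Then \<kappa> s =
  \<kappa> t on the whole manifold, and homogeneity turns this into equality of T s and T t at
  p.\<close>

lemma homogeneous_section_local:
  fixes T :: "('m \<Rightarrow> 'v) \<Rightarrow> 'm \<Rightarrow> 'v"
  assumes hom: "\<And>f s. f \<in> smooth_functions \<Longrightarrow> s \<in> sections \<Longrightarrow> T (\<lambda>p. f p *\<^sub>R s p) = (\<lambda>p. f p *\<^sub>R T s p)"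
    and s: "s \<in> sections" and t: "t \<in> sections"
    and N: "open N" "p \<in> N" "\<And>q. q \<in> N \<Longrightarrow> s q = t q"
  shows "T s p = T t p"
proof -
  obtain \<kappa> M K where \<kappa>: "\<kappa> \<in> smooth_functions" and "open M" "p \<in> M" "\<And>q. q \<in> M \<Longrightarrow> \<kappa> q = 1"
    and "closed K" "K \<subseteq> N" "\<And>q. q \<notin> K \<Longrightarrow> \<kappa> q = 0"
    using bump_function_exists[OF N(1,2)] by blast
  then have "\<kappa> p = 1" and "(\<lambda>q. \<kappa> q *\<^sub>R s q) = (\<lambda>q. \<kappa> q *\<^sub>R t q)"
    using N(3) by (auto simp: fun_eq_iff)
  then show ?thesis using fun_cong[OF hom[OF \<kappa> s], of p] fun_cong[OF hom[OF \<kappa> t], of p] by simp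
qed

lemma homogeneous_form_local:
  fixes T :: "('m \<Rightarrow> 'v \<Rightarrow> real) \<Rightarrow> 'm \<Rightarrow> 'v"
  assumes hom: "\<And>f \<omega>. f \<in> smooth_functions \<Longrightarrow> \<omega> \<in> forms \<Longrightarrow> T (\<lambda>p x. f p * \<omega> p x) = (\<lambda>p. f p *\<^sub>R T \<omega> p)"
    and \<omega>: "\<omega> \<in> forms" and \<eta>: "\<eta> \<in> forms"
    and N: "open N" "p \<in> N" "\<And>q. q \<in> N \<Longrightarrow> \<omega> q = \<eta> q"
  shows "T \<omega> p = T \<eta> p"
proof -
  obtain \<kappa> M K where \<kappa>: "\<kappa> \<in> smooth_functions" and "open M" "p \<in> M" "\<And>q. q \<in> M \<Longrightarrow> \<kappa> q = 1"
    and "closed K" "K \<subseteq> N" "\<And>q. q \<notin> K \<Longrightarrow> \<kappa> q = 0"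
    using bump_function_exists[OF N(1,2)] by blast
  then have "\<kappa> p = 1" and "(\<lambda>q x. \<kappa> q * \<omega> q x) = (\<lambda>q x. \<kappa> q * \<eta> q x)"
    using N(3) by (auto simp: fun_eq_iff) (metis subsetD)
  then show ?thesis using fun_cong[OF hom[OF \<kappa> \<omega>], of p] fun_cong[OF hom[OF \<kappa> \<eta>], of p] by simp
qed

lemma tensorial_section_sum:
  fixes T :: "('m \<Rightarrow> 'v) \<Rightarrow> 'm \<Rightarrow> 'v"
  assumes hom: "\<And>f s. f \<in> smooth_functions \<Longrightarrow> s \<in> sections \<Longrightarrow> T (\<lambda>p. f p *\<^sub>R s p) = (\<lambda>p. f p *\<^sub>R T s p)"
    and add: "\<And>s t. s \<in> sections \<Longrightarrow> t \<in> sections \<Longrightarrow> T (\<lambda>p. s p + t p) = (\<lambda>p. T s p + T t p)"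
    and "finite A" and "\<And>a. a \<in> A \<Longrightarrow> g a \<in> smooth_functions" and "\<And>a. a \<in> A \<Longrightarrow> s a \<in> sections"
  shows "T (\<lambda>p. \<Sum>a\<in>A. g a p *\<^sub>R s a p) = (\<lambda>p. \<Sum>a\<in>A. g a p *\<^sub>R T (s a) p)"
  using assms(3-)
proof (induction A rule: finite_induct)
  case empty
  \<comment> \<open>Homogeneity with the factor 0 gives T 0 = 0.\<close>
  show ?case using hom[OF const_smooth[of 0] sections_zero] by simp
next
  case (insert a A)
  have "T (\<lambda>p. g a p *\<^sub>R s a p + (\<Sum>a\<in>A. g a p *\<^sub>R s a p)) =
      (\<lambda>p. T (\<lambda>p. g a p *\<^sub>R s a p) p + T (\<lambda>p. \<Sum>a\<in>A. g a p *\<^sub>R s a p) p)"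
    by (rule add) (simp_all add: insert.prems sections_scale sections_sum)
  then show ?case using insert by (simp add: hom)
qed

lemma tensorial_form_sum:
  fixes T :: "('m \<Rightarrow> 'v \<Rightarrow> real) \<Rightarrow> 'm \<Rightarrow> 'v"
  assumes hom: "\<And>f \<omega>. f \<in> smooth_functions \<Longrightarrow> \<omega> \<in> forms \<Longrightarrow> T (\<lambda>p x. f p * \<omega> p x) = (\<lambda>p. f p *\<^sub>R T \<omega> p)"
    and add: "\<And>\<omega> \<eta>. \<omega> \<in> forms \<Longrightarrow> \<eta> \<in> forms \<Longrightarrow> T (\<lambda>p x. \<omega> p x + \<eta> p x) = (\<lambda>p. T \<omega> p + T \<eta> p)"
    and "finite A" and "\<And>a. a \<in> A \<Longrightarrow> g a \<in> smooth_functions" and "\<And>a. a \<in> A \<Longrightarrow> \<omega> a \<in> forms"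
  shows "T (\<lambda>p x. \<Sum>a\<in>A. g a p * \<omega> a p x) = (\<lambda>p. \<Sum>a\<in>A. g a p *\<^sub>R T (\<omega> a) p)"
  using assms(3-)
proof (induction A rule: finite_induct)
  case empty
  show ?case using hom[OF const_smooth[of 0] forms_zero] by simp
next
  case (insert a A)
  have "T (\<lambda>p x. g a p * \<omega> a p x + (\<Sum>a\<in>A. g a p * \<omega> a p x)) =
      (\<lambda>p. T (\<lambda>p x. g a p * \<omega> a p x) p + T (\<lambda>p x. \<Sum>a\<in>A. g a p * \<omega> a p x) p)"
    by (rule add) (simp_all add: insert.prems forms_scale forms_sum)
  then show ?case using insert by (simp add: hom)
qed

section \<open>Global families that resolve the identity near a point\<close>

text \<open>Near a point the identity of E is the sum of the tensors of \<open>e a\<close> and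
  \<open>X a\<close>. This relation, unlike being a dual pair of frames, can be stated for global
  families and holds on an open set, so one family serves all nearby points.\<close>

definition adapted :: "'m set \<Rightarrow> (nat \<Rightarrow> 'm \<Rightarrow> 'v) \<Rightarrow> (nat \<Rightarrow> 'm \<Rightarrow> 'v \<Rightarrow> real) \<Rightarrow> bool" where
  "adapted N X e \<longleftrightarrow> open N \<and> (\<forall>a<rank. X a \<in> sections \<and> e a \<in> forms) \<and>
     (\<forall>q\<in>N. \<forall>x\<in>E q. (\<Sum>a<rank. e a q x *\<^sub>R X a q) = x)"

text \<open>The condition under the definite description in \<^const>\<open>contraction\<close>.\<close>

definition frame_extension ::
  "'m \<Rightarrow> 'm set \<Rightarrow> (nat \<Rightarrow> 'm \<Rightarrow> 'v) \<Rightarrow> (nat \<Rightarrow> 'm \<Rightarrow> 'v \<Rightarrow> real) \<Rightarrow>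
   (nat \<Rightarrow> 'm \<Rightarrow> 'v) \<Rightarrow> (nat \<Rightarrow> 'm \<Rightarrow> 'v \<Rightarrow> real) \<Rightarrow> bool" where
  "frame_extension p W X e X' e' \<longleftrightarrow>
     p \<in> W \<and> local_frame W X \<and> dual_coframe W X e \<and>
     (\<forall>a<rank. X' a \<in> sections \<and> (\<forall>\<^sub>F q in nhds p. X' a q = X a q)) \<and>
     (\<forall>a<rank. e' a \<in> forms \<and> (\<forall>\<^sub>F q in nhds p. e' a q = e a q))"

text \<open>There are finitely many indices, so the extensions agree with the frame and coframe on a
  common neighbourhood, where the expansion of vectors carries over.\<close>

lemma frame_extension_adapted:
  assumes "frame_extension p W X e X' e'"
  obtains N where "p \<in> N" and "adapted N X' e'"
proof -
  from assms have W: "p \<in> W" "local_frame W X" "dual_coframe W X e"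
    and X': "\<And>a. a < rank \<Longrightarrow> X' a \<in> sections" and e': "\<And>a. a < rank \<Longrightarrow> e' a \<in> forms"
    and ev: "\<forall>a\<in>{..<rank}. \<forall>\<^sub>F q in nhds p. X' a q = X a q \<and> e' a q = e a q"
    unfolding frame_extension_def by (simp_all add: eventually_conj)
  from ev have "\<forall>\<^sub>F q in nhds p. \<forall>a\<in>{..<rank}. X' a q = X a q \<and> e' a q = e a q"
    by (intro eventually_ball_finite) auto
  then obtain M where M: "open M" "p \<in> M"
    "\<And>q a. q \<in> M \<Longrightarrow> a < rank \<Longrightarrow> X' a q = X a q \<and> e' a q = e a q"
    unfolding eventually_nhds by blast
  have "adapted (W \<inter> M) X' e'"
    unfolding adapted_def
  proof (intro conjI allI impI ballI)
    show "open (W \<inter> M)" using W(2) M(1) by (simp add: local_frame_def open_Int)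
    fix q x assume "q \<in> W \<inter> M" "x \<in> E q"
    then show "(\<Sum>a<rank. e' a q x *\<^sub>R X' a q) = x"
      using M(3) frame_expand[OF W(2,3), of q x] by simp
  qed (simp_all add: X' e')
  then show thesis using that W(1) M(2) by blast
qed

text \<open>Existence for the definite description: a trivialization frame and its coframe are both
  multiplied by a bump function equal to 1 near p.\<close>

lemma frame_extension_exists:
  obtains W X e X' e' where "frame_extension p W X e X' e'"
proof -
  obtain U \<theta> where U: "(U, \<theta>) \<in> trivs" and p: "p \<in> U" by (rule triv_around)
  note open_U = triv_open[OF U] and frame = triv_local_frame[OF U] and coframe = triv_dual_coframe[OF U]
  obtain \<kappa> N K where \<kappa>: "\<kappa> \<in> smooth_functions" and N: "open N" "p \<in> N" "\<And>q. q \<in> N \<Longrightarrow> \<kappa> q = 1"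
    and K: "closed K" "K \<subseteq> U" "\<And>q. q \<notin> K \<Longrightarrow> \<kappa> q = 0"
    using bump_function_exists[OF open_U p] by blast
  have ev: "\<forall>\<^sub>F q in nhds p. \<kappa> q = 1" using N unfolding eventually_nhds by blast
  have "frame_extension p U (triv_frame \<theta>) (triv_coframe \<theta>)
      (\<lambda>a q. \<kappa> q *\<^sub>R triv_frame \<theta> a q) (\<lambda>a q x. \<kappa> q * triv_coframe \<theta> a q x)"
    unfolding frame_extension_def
  proof (intro conjI allI impI)
    fix a assume a: "a < rank"
    show "(\<lambda>q. \<kappa> q *\<^sub>R triv_frame \<theta> a q) \<in> sections"
      using frame a by (intro section_extend[OF _ open_U K(1,2) \<kappa> K(3)]) (auto simp: local_frame_def)
    show "(\<lambda>q x. \<kappa> q * triv_coframe \<theta> a q x) \<in> forms"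
      using coframe a by (intro form_extend[OF _ open_U K(1,2) \<kappa> K(3)]) (auto simp: dual_coframe_def)
    show "\<forall>\<^sub>F q in nhds p. \<kappa> q *\<^sub>R triv_frame \<theta> a q = triv_frame \<theta> a q"
      using ev by (rule eventually_mono) simp
    show "\<forall>\<^sub>F q in nhds p. (\<lambda>x. \<kappa> q * triv_coframe \<theta> a q x) = triv_coframe \<theta> a q"
      using ev by (rule eventually_mono) simp
  qed (use p frame coframe in auto)
  then show thesis by (rule that)
qed

lemma adapted_exists: obtains N X e where "p \<in> N" and "adapted N X e"
  by (metis frame_extension_exists frame_extension_adapted)

end

section \<open>The modified bracket\<close>

context anchored_vector_bundle
begin

lemma D_form:
  assumes "f \<in> smooth_functions"
  shows "D f \<in> forms"
  unfolding forms_def mem_Collect_eq form_on_iff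
proof (intro conjI ballI allI impI)
  fix p show "D f p \<in> dual_fibre p"
    using fibre_subspace[of p]
    by (auto simp: dual_fibre_def D_def anchor_add anchor_scale subspace_add subspace_scale)
next
  fix U \<theta> c assume U: "(U, \<theta>) \<in> trivs" "c \<in> tuples rank"
  have "smooth_fun_on U (\<lambda>p. \<rho> p (inv_into (E p) (\<theta> p) c) f)"
    using anchor_smooth[OF U] assms by (simp add: smooth_vector_field_on_def)
  then show "smooth_fun_on (U \<inter> UNIV) (\<lambda>p. D f p (inv_into (E p) (\<theta> p) c))"
    unfolding Int_UNIV_right by (rule smooth_fun_on_cong[rotated 2])
      (use triv_open[OF U(1)] triv_inv(1)[OF U(1) _ U(2)] in \<open>auto simp: D_def\<close>)
qed

lemma anchor_action_eq: "u \<in> sections \<Longrightarrow> anchor_action u f = (\<lambda>p. D f p (u p))"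
  by (simp add: anchor_action_def D_def sections_in)

lemma anchor_action_smooth:
  "u \<in> sections \<Longrightarrow> f \<in> smooth_functions \<Longrightarrow> anchor_action u f \<in> smooth_functions"
  by (simp add: anchor_action_eq pairing_smooth D_form)

text \<open>A derivation maps 1 = 1 * 1 to twice its value there, hence to 0; other constants follow
  by scaling.\<close>

lemma D_const: "D (\<lambda>p. r) = (\<lambda>p x. 0)"
proof (intro ext)
  fix p x
  show "D (\<lambda>p. r) p x = 0"
  proof (cases "x \<in> E p")
    case True
    note tangent = anchor_tangent[OF True, unfolded tangent_space_def mem_Collect_eq]
    have mult: "\<rho> p x (\<lambda>q. f q * g q) = f p * \<rho> p x g + g p * \<rho> p x f"
      if "f \<in> smooth_functions" "g \<in> smooth_functions" for f g
      using tangent that by simp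
    from mult[OF const_smooth const_smooth, of 1 1] have unit: "\<rho> p x (\<lambda>q. 1) = 0" by simp
    have scale: "\<rho> p x (\<lambda>q. r * f q) = r * \<rho> p x f" if "f \<in> smooth_functions" for f
      using tangent that by simp
    from scale[OF const_smooth, of 1] have "\<rho> p x (\<lambda>q. r) = r * \<rho> p x (\<lambda>q. 1)" by simp
    with unit show ?thesis by (simp add: D_def)
  qed (simp add: D_def)
qed

end

context linear_connection
begin

lemma nabla_closed: "u \<in> sections \<Longrightarrow> v \<in> sections \<Longrightarrow> nabla u v \<in> sections"
  using nabla_bilinear by (simp add: real_bilinear_def)

lemma nabla_add1: "u \<in> sections \<Longrightarrow> v \<in> sections \<Longrightarrow> w \<in> sections \<Longrightarrow>
    nabla (\<lambda>p. u p + v p) w = (\<lambda>p. nabla u w p + nabla v w p)"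
  using nabla_bilinear by (simp add: real_bilinear_def)

lemma nabla_add2: "u \<in> sections \<Longrightarrow> v \<in> sections \<Longrightarrow> w \<in> sections \<Longrightarrow>
    nabla w (\<lambda>p. u p + v p) = (\<lambda>p. nabla w u p + nabla w v p)"
  using nabla_bilinear by (simp add: real_bilinear_def)

end

locale leibniz_connection =
  local_almost_leibniz_algebroid charts E rank trivs \<rho> bracket L +
  linear_connection charts E rank trivs \<rho> nabla
  for charts :: "('m::{t2_space,second_countable_topology} set
                  \<times> ('m \<Rightarrow> 'c::{real_inner,heine_borel})) set"
    and E :: "'m \<Rightarrow> 'v::real_vector set"
    and rank :: nat
    and trivs :: "('m set \<times> ('m \<Rightarrow> 'v \<Rightarrow> nat \<Rightarrow> real)) set"
    and \<rho> :: "'m \<Rightarrow> 'v \<Rightarrow> ('m \<Rightarrow> real) \<Rightarrow> real"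
    and bracket :: "('m \<Rightarrow> 'v) \<Rightarrow> ('m \<Rightarrow> 'v) \<Rightarrow> ('m \<Rightarrow> 'v)"
    and L :: "('m \<Rightarrow> 'v \<Rightarrow> real) \<Rightarrow> ('m \<Rightarrow> 'v) \<Rightarrow> ('m \<Rightarrow> 'v) \<Rightarrow> ('m \<Rightarrow> 'v)"
    and nabla :: "('m \<Rightarrow> 'v) \<Rightarrow> ('m \<Rightarrow> 'v) \<Rightarrow> ('m \<Rightarrow> 'v)"
begin

section \<open>The contraction: independence, smoothness, behaviour under scaling\<close>

text \<open>With A_ab = e^a(Y_b) one has e^a = \<Sum>_b A_ab f^b and Y_b = \<Sum>_a A_ab X_a near p.
  Both sides therefore equal the double sum of A_ab L(f^b, \<nabla>_{X_a} u, v) at p.\<close>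

lemma contraction_independent:
  assumes Xe: "adapted N X e" "p \<in> N" and Yf: "adapted M Y f" "p \<in> M"
    and u: "u \<in> sections" and v: "v \<in> sections"
  shows "(\<Sum>a<rank. L (e a) (nabla (X a) u) v p) = (\<Sum>b<rank. L (f b) (nabla (Y b) u) v p)"
proof -
  define A where "A a b q = e a q (Y b q)" for a b q
  have X: "X a \<in> sections" and e: "e a \<in> forms" if "a < rank" for a
    using that Xe(1) by (simp_all add: adapted_def)
  have Y: "Y b \<in> sections" and f: "f b \<in> forms" if "b < rank" for b
    using that Yf(1) by (simp_all add: adapted_def)
  have A: "A a b \<in> smooth_functions" if "a < rank" "b < rank" for a b
    unfolding A_def by (rule pairing_smooth[OF e[OF that(1)] Y[OF that(2)]])
  have NM: "open (N \<inter> M)" "p \<in> N \<inter> M"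
    using Xe Yf by (simp_all add: adapted_def open_Int)
  have Y_eq: "(\<Sum>a<rank. A a b q *\<^sub>R X a q) = Y b q" if "q \<in> N \<inter> M" "b < rank" for b q
    using that Xe(1) sections_in[OF Y[OF that(2)]] by (simp add: adapted_def A_def)
  \<comment> \<open>Equality of forms is equality of functions on all of \<open>'v\<close>; outside
    the fibre both sides are 0 by the convention of \<open>dual_fibre\<close>.\<close>
  have e_eq: "(\<lambda>x. \<Sum>b<rank. A a b q * f b q x) = e a q" if q: "q \<in> N \<inter> M" and a: "a < rank" for a q
  proof
    fix x
    show "(\<Sum>b<rank. A a b q * f b q x) = e a q x"
    proof (cases "x \<in> E q")
      case True
      then have "e a q x = e a q (\<Sum>b<rank. f b q x *\<^sub>R Y b q)"
        using Yf(1) q by (simp add: adapted_def)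
      also have "\<dots> = (\<Sum>b<rank. f b q x * e a q (Y b q))"
        by (rule dual_fibre_sum[OF forms_in[OF e[OF a]]]) (simp add: sections_in Y)
      finally show ?thesis by (simp add: A_def mult.commute)
    next
      case False
      then have "e a q x = 0" "\<And>b. b < rank \<Longrightarrow> f b q x = 0"
        using forms_in[OF e[OF a], of q] forms_in[OF f, of _ q] by (simp_all add: dual_fibre_def)
      then show ?thesis by simp
    qed
  qed
  have e_expand: "L (e a) (nabla (X a) u) v p = (\<Sum>b<rank. A a b p *\<^sub>R L (f b) (nabla (X a) u) v p)"
    if a: "a < rank" for a
  proof -
    let ?T = "\<lambda>\<omega>. L \<omega> (nabla (X a) u) v"
    note n = nabla_closed[OF X[OF a] u]
    \<comment> \<open>The expansion of \<open>e a\<close> holds on \<open>N \<inter> M\<close> only,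
      so locality replaces \<open>e a\<close> by a global sum before linearity is applied.\<close>
    have "?T (e a) p = ?T (\<lambda>q x. \<Sum>b<rank. A a b q * f b q x) p"
    proof (rule homogeneous_form_local[where T = ?T, OF L_scale1 e[OF a] _ NM])
      show "(\<lambda>q x. \<Sum>b<rank. A a b q * f b q x) \<in> forms"
        by (intro forms_sum forms_scale A f) (simp_all add: a)
    qed (simp_all add: n v a e_eq[simplified])
    also have "\<dots> = (\<Sum>b<rank. A a b p *\<^sub>R ?T (f b) p)"
      by (subst tensorial_form_sum[where T = ?T, OF L_scale1 L_add1]) (simp_all add: n v a A f)
    finally show ?thesis .
  qed
  have Y_expand: "L (f b) (nabla (Y b) u) v p = (\<Sum>a<rank. A a b p *\<^sub>R L (f b) (nabla (X a) u) v p)"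
    if b: "b < rank" for b
  proof -
    \<comment> \<open>This composite is function-linear in s since \<open>nabla\<close> is so in its
      first slot and \<open>L\<close> in its second.\<close>
    let ?T = "\<lambda>s. L (f b) (nabla s u) v"
    have hom: "?T (\<lambda>p. g p *\<^sub>R s p) = (\<lambda>p. g p *\<^sub>R ?T s p)"
      if "g \<in> smooth_functions" "s \<in> sections" for g s
      using that by (simp add: nabla_tensorial L_scale2 nabla_closed f b u v)
    have add: "?T (\<lambda>p. s p + t p) = (\<lambda>p. ?T s p + ?T t p)"
      if "s \<in> sections" "t \<in> sections" for s t
      using that by (simp add: nabla_add1 L_add2 nabla_closed f b u v)
    have "?T (Y b) p = ?T (\<lambda>q. \<Sum>a<rank. A a b q *\<^sub>R X a q) p"
    proof (rule homogeneous_section_local[where T = ?T, OF hom Y[OF b] _ NM])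
      show "(\<lambda>q. \<Sum>a<rank. A a b q *\<^sub>R X a q) \<in> sections"
        by (intro sections_sum sections_scale A X) (simp_all add: b)
    qed (simp_all add: b Y_eq[simplified])
    also have "\<dots> = (\<Sum>a<rank. A a b p *\<^sub>R ?T (X a) p)"
      by (subst tensorial_section_sum[where T = ?T, OF hom add]) (simp_all add: b A X)
    finally show ?thesis .
  qed
  have "(\<Sum>a<rank. L (e a) (nabla (X a) u) v p) =
      (\<Sum>a<rank. \<Sum>b<rank. A a b p *\<^sub>R L (f b) (nabla (X a) u) v p)"
    by (rule sum.cong[OF refl], rule e_expand) simp
  also have "\<dots> = (\<Sum>b<rank. \<Sum>a<rank. A a b p *\<^sub>R L (f b) (nabla (X a) u) v p)"
    by (rule sum.swap)
  also have "\<dots> = (\<Sum>b<rank. L (f b) (nabla (Y b) u) v p)"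
    by (rule sum.cong[OF refl], rule Y_expand[symmetric]) simp
  finally show ?thesis .
qed

lemma contraction_eq:
  assumes "adapted N X e" and "p \<in> N" and "u \<in> sections" and "v \<in> sections"
  shows "contraction L nabla u v p = (\<Sum>a<rank. L (e a) (nabla (X a) u) v p)"
proof -
  have indep: "(\<Sum>a<rank. L (e' a) (nabla (X' a) u) v p) = (\<Sum>a<rank. L (e a) (nabla (X a) u) v p)"
    if "frame_extension p W Y f X' e'" for W Y f X' e'
    by (rule frame_extension_adapted[OF that]) (rule contraction_independent[OF _ _ assms])
  have "contraction L nabla u v p = (THE y. \<exists>W Y f X' e'.
      frame_extension p W Y f X' e' \<and> y = (\<Sum>a<rank. L (e' a) (nabla (X' a) u) v p))"
    unfolding contraction_def frame_extension_def conj_assoc ..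
  also have "\<dots> = (\<Sum>a<rank. L (e a) (nabla (X a) u) v p)"
  proof (rule the_equality)
    obtain W Y f X' e' where "frame_extension p W Y f X' e'" by (rule frame_extension_exists)
    with indep[OF this, symmetric] show "\<exists>W Y f X' e'. frame_extension p W Y f X' e' \<and>
        (\<Sum>a<rank. L (e a) (nabla (X a) u) v p) = (\<Sum>a<rank. L (e' a) (nabla (X' a) u) v p)"
      by (intro exI conjI)
  qed (elim exE conjE, simp only: indep)
  finally show ?thesis .
qed

text \<open>One adapted family computes the contraction on a whole neighbourhood, where it thus
  coincides with a finite sum of global sections.\<close>

lemma contraction_section:
  assumes u: "u \<in> sections" and v: "v \<in> sections"
  shows "contraction L nabla u v \<in> sections"
proof (rule section_on_locally)
  fix p
  obtain N X e where p: "p \<in> N" and N: "adapted N X e" by (rule adapted_exists)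
  have "(\<lambda>q. \<Sum>a<rank. L (e a) (nabla (X a) u) v q) \<in> sections"
    using N by (intro sections_sum L_closed nabla_closed u v) (auto simp: adapted_def)
  then have "section_on N (\<lambda>q. \<Sum>a<rank. L (e a) (nabla (X a) u) v q)"
    by (rule sections_on)
  then have "section_on N (contraction L nabla u v)"
    by (rule section_on_cong[rotated 2]) (use N contraction_eq[OF N _ u v] in \<open>auto simp: adapted_def\<close>)
  then show "\<exists>N. open N \<and> p \<in> N \<and> section_on N (contraction L nabla u v)"
    using p N by (auto simp: adapted_def)
qed

lemma contraction_add1:
  assumes "u \<in> sections" "w \<in> sections" "v \<in> sections"
  shows "contraction L nabla (\<lambda>p. u p + w p) v = (\<lambda>p. contraction L nabla u v p + contraction L nabla w v p)"
proof
  fix p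
  obtain N X e where p: "p \<in> N" and N: "adapted N X e" by (rule adapted_exists)
  then have "X a \<in> sections" "e a \<in> forms" if "a < rank" for a
    using that by (simp_all add: adapted_def)
  then show "contraction L nabla (\<lambda>p. u p + w p) v p = contraction L nabla u v p + contraction L nabla w v p"
    using assms by (simp add: contraction_eq[OF N p] sections_add nabla_add2 L_add2 nabla_closed sum.distrib)
qed

lemma contraction_add2:
  assumes "u \<in> sections" "w \<in> sections" "v \<in> sections"
  shows "contraction L nabla v (\<lambda>p. u p + w p) = (\<lambda>p. contraction L nabla v u p + contraction L nabla v w p)"
proof
  fix p
  obtain N X e where p: "p \<in> N" and N: "adapted N X e" by (rule adapted_exists)
  then have "X a \<in> sections" "e a \<in> forms" if "a < rank" for a
    using that by (simp_all add: adapted_def)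
  then show "contraction L nabla v (\<lambda>p. u p + w p) p = contraction L nabla v u p + contraction L nabla v w p"
    using assms by (simp add: contraction_eq[OF N p] sections_add L_add3 nabla_closed sum.distrib)
qed

lemma contraction_scale2:
  assumes "f \<in> smooth_functions" "u \<in> sections" "v \<in> sections"
  shows "contraction L nabla u (\<lambda>p. f p *\<^sub>R v p) = (\<lambda>p. f p *\<^sub>R contraction L nabla u v p)"
proof
  fix p
  obtain N X e where p: "p \<in> N" and N: "adapted N X e" by (rule adapted_exists)
  then have "X a \<in> sections" "e a \<in> forms" if "a < rank" for a
    using that by (simp_all add: adapted_def)
  then show "contraction L nabla u (\<lambda>p. f p *\<^sub>R v p) p = f p *\<^sub>R contraction L nabla u v p"
    using assms
    by (simp add: contraction_eq[OF N p] sections_scale L_scale3 nabla_closed scaleR_sum_right)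
qed

text \<open>Applying D f to the expansion of x shows that near p the coefficients of D f are
  \<rho>(X_a)(f). The Leibniz rule of \<open>nabla\<close> produces the same coefficients in the
  second slot of \<open>L\<close>, and function-linearity moves them to the first.\<close>

lemma contraction_scale1:
  assumes f: "f \<in> smooth_functions" and u: "u \<in> sections" and v: "v \<in> sections"
  shows "contraction L nabla (\<lambda>p. f p *\<^sub>R u p) v = (\<lambda>p. L (D f) u v p + f p *\<^sub>R contraction L nabla u v p)"
proof
  fix p
  obtain N X e where p: "p \<in> N" and N: "adapted N X e" by (rule adapted_exists)
  then have X: "X a \<in> sections" and e: "e a \<in> forms" if "a < rank" for a
    using that by (simp_all add: adapted_def)
  have smooth: "anchor_action (X a) f \<in> smooth_functions" if "a < rank" for a
    by (rule anchor_action_smooth[OF X[OF that] f])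
  let ?\<omega> = "\<lambda>q x. \<Sum>a<rank. anchor_action (X a) f q * e a q x"
  have D_eq: "D f q = ?\<omega> q" if q: "q \<in> N" for q
  proof
    fix x
    show "D f q x = ?\<omega> q x"
    proof (cases "x \<in> E q")
      case True
      then have "D f q x = D f q (\<Sum>a<rank. e a q x *\<^sub>R X a q)"
        using N q by (simp add: adapted_def)
      also have "\<dots> = (\<Sum>a<rank. e a q x * D f q (X a q))"
        by (rule dual_fibre_sum[OF forms_in[OF D_form[OF f]]]) (simp add: sections_in X)
      finally show ?thesis by (simp add: anchor_action_eq X mult.commute)
    next
      case False
      then have "e a q x = 0" if "a < rank" for a
        using forms_in[OF e[OF that], of q] by (simp add: dual_fibre_def)
      with False show ?thesis by (simp add: D_def)
    qed
  qed
  have "L (D f) u v p = L ?\<omega> u v p"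
  proof (rule homogeneous_form_local[where T = "\<lambda>\<omega>. L \<omega> u v", OF L_scale1 D_form[OF f] _ _ p D_eq])
    show "?\<omega> \<in> forms" by (intro forms_sum forms_scale smooth e) simp_all
  qed (use N in \<open>simp_all add: adapted_def u v\<close>)
  also have "\<dots> = (\<Sum>a<rank. anchor_action (X a) f p *\<^sub>R L (e a) u v p)"
    by (subst tensorial_form_sum[where T = "\<lambda>\<omega>. L \<omega> u v", OF L_scale1 L_add1])
      (simp_all add: u v e smooth)
  finally have L_eq: "L (D f) u v p = \<dots>" .
  have "L (e a) (nabla (X a) (\<lambda>p. f p *\<^sub>R u p)) v p =
      anchor_action (X a) f p *\<^sub>R L (e a) u v p + f p *\<^sub>R L (e a) (nabla (X a) u) v p"
    if a: "a < rank" for a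
    using X[OF a] e[OF a] smooth[OF a] f u v
    by (simp add: nabla_leibniz L_add2 L_scale2 sections_scale nabla_closed)
  then show "contraction L nabla (\<lambda>p. f p *\<^sub>R u p) v p = L (D f) u v p + f p *\<^sub>R contraction L nabla u v p"
    using f u v
    by (simp add: contraction_eq[OF N p] sections_scale L_eq sum.distrib scaleR_sum_right)
qed

text \<open>For a constant factor the extra term is L(0, u, v), which vanishes by
  homogeneity.\<close>

lemma contraction_scaleR1:
  assumes "u \<in> sections" and "v \<in> sections"
  shows "contraction L nabla (\<lambda>p. r *\<^sub>R u p) v = (\<lambda>p. r *\<^sub>R contraction L nabla u v p)"
proof -
  have "L (D (\<lambda>p. r)) u v = (\<lambda>p. 0)"
    using L_scale1[OF const_smooth[of 0] forms_zero assms] by (simp add: D_const)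
  then show ?thesis using contraction_scale1[OF const_smooth[of r] assms] by simp
qed

section \<open>Leibniz rules and antisymmetry of the modified bracket\<close>

abbreviation mod_bracket where "mod_bracket \<equiv> modified_bracket bracket L nabla"

lemma mod_bracket_bilinear: "real_bilinear mod_bracket"
  using bracket_bilinear
  by (simp add: real_bilinear_def modified_bracket_def sections_diff contraction_section
      contraction_add1 contraction_add2 contraction_scaleR1 contraction_scale2[OF const_smooth]
      algebra_simps)

lemma mod_bracket_right_leibniz:
  assumes "u \<in> sections" "v \<in> sections" "f \<in> smooth_functions"
  shows "mod_bracket u (\<lambda>p. f p *\<^sub>R v p)
    = (\<lambda>p. anchor_action u f p *\<^sub>R v p + f p *\<^sub>R mod_bracket u v p)"
  using assms
  by (simp add: modified_bracket_def bracket_right_leibniz contraction_scale2 algebra_simps)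

text \<open>The bracket and the contraction both contribute L(D f, u, v), and the subtraction
  cancels it.\<close>

lemma mod_bracket_left_leibniz:
  assumes "u \<in> sections" "v \<in> sections" "f \<in> smooth_functions"
  shows "mod_bracket (\<lambda>p. f p *\<^sub>R u p) v
    = (\<lambda>p. f p *\<^sub>R mod_bracket u v p - anchor_action v f p *\<^sub>R u p)"
  using assms
  by (simp add: modified_bracket_def bracket_left_leibniz contraction_scale1 algebra_simps)

lemma mod_bracket_almost_dull: "almost_dull_algebroid charts E rank trivs \<rho> mod_bracket"
proof unfold_locales
  show "real_bilinear mod_bracket" by (rule mod_bracket_bilinear)
next
  fix u v f g
  assume *: "u \<in> sections" "v \<in> sections" "f \<in> smooth_functions" "g \<in> smooth_functions"
  \<comment> \<open>Splitting off g in the second slot leaves the anchor of f u acting on g, from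
    which fibrewise linearity extracts f.\<close>
  have "anchor_action (\<lambda>p. f p *\<^sub>R u p) g = (\<lambda>p. f p * anchor_action u g p)"
    using *(1) by (simp add: anchor_action_def anchor_scale sections_in)
  then show "mod_bracket (\<lambda>p. f p *\<^sub>R u p) (\<lambda>p. g p *\<^sub>R v p)
      = (\<lambda>p. (f p * g p) *\<^sub>R mod_bracket u v p + (f p * anchor_action u g p) *\<^sub>R v p
             - (g p * anchor_action v f p) *\<^sub>R u p)"
    using * by (simp add: mod_bracket_right_leibniz mod_bracket_left_leibniz sections_scale
        algebra_simps)
qed

text \<open>Admissibility equates the symmetrizations of the bracket and of the contraction, so
  their difference has symmetrization zero.\<close>

lemma mod_bracket_almost_lie:
  assumes "admissible bracket L nabla"
  shows "almost_lie_algebroid charts E rank trivs \<rho> mod_bracket"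
proof unfold_locales
  show "real_bilinear mod_bracket" by (rule mod_bracket_bilinear)
next
  fix u v f assume "u \<in> sections" "v \<in> sections" "f \<in> smooth_functions"
  then show "mod_bracket u (\<lambda>p. f p *\<^sub>R v p)
      = (\<lambda>p. anchor_action u f p *\<^sub>R v p + f p *\<^sub>R mod_bracket u v p)"
    by (rule mod_bracket_right_leibniz)
next
  fix u v assume *: "u \<in> sections" "v \<in> sections"
  have "mod_bracket u v p = - mod_bracket v u p" for p
  proof -
    have "bracket u v p + bracket v u p = contraction L nabla u v p + contraction L nabla v u p"
      using assms * unfolding admissible_def by (meson fun_cong)
    then have "(bracket u v p - contraction L nabla u v p) + (bracket v u p - contraction L nabla v u p) = 0"
      by (simp add: algebra_simps)
    then show ?thesis unfolding modified_bracket_def by (rule add_eq_0_iff2[THEN iffD1])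
  qed
  then show "mod_bracket u v = (\<lambda>p. - mod_bracket v u p)" by (rule ext)
qed

end

theorem proposition3p3:
  fixes charts :: "('m::{t2_space,second_countable_topology} set
                    \<times> ('m \<Rightarrow> 'c::{real_inner,heine_borel})) set"
    and E :: "'m \<Rightarrow> 'v::real_vector set"
    and rank :: nat
    and trivs :: "('m set \<times> ('m \<Rightarrow> 'v \<Rightarrow> nat \<Rightarrow> real)) set"
    and \<rho> :: "'m \<Rightarrow> 'v \<Rightarrow> ('m \<Rightarrow> real) \<Rightarrow> real"
    and bracket :: "('m \<Rightarrow> 'v) \<Rightarrow> ('m \<Rightarrow> 'v) \<Rightarrow> ('m \<Rightarrow> 'v)"
    and L :: "('m \<Rightarrow> 'v \<Rightarrow> real) \<Rightarrow> ('m \<Rightarrow> 'v) \<Rightarrow> ('m \<Rightarrow> 'v) \<Rightarrow> ('m \<Rightarrow> 'v)"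
    and nabla :: "('m \<Rightarrow> 'v) \<Rightarrow> ('m \<Rightarrow> 'v) \<Rightarrow> ('m \<Rightarrow> 'v)"
  assumes "local_almost_leibniz_algebroid charts E rank trivs \<rho> bracket L"
    and "linear_connection charts E rank trivs \<rho> nabla"
  shows "almost_dull_algebroid charts E rank trivs \<rho>
           (vector_bundle.modified_bracket charts E rank trivs bracket L nabla) \<and>
         (vector_bundle.admissible charts E rank trivs bracket L nabla \<longrightarrow>
          almost_lie_algebroid charts E rank trivs \<rho>
            (vector_bundle.modified_bracket charts E rank trivs bracket L nabla))"
proof -
  interpret leibniz_connection charts E rank trivs \<rho> bracket L nabla
    by (rule leibniz_connection.intro[OF assms])
  show ?thesis using mod_bracket_almost_dull mod_bracket_almost_lie by blast
qed

end
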